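(* Let $V$ be a finite set and let $R_V$ be the set of coloured graphs with vertex set $V$ whose graph colouring is regular. Let $\mathcal{S}^{+}_{R_V}=\{\mathcal{S}^{+}(\mathcal{V},\mathcal{E}) : (\mathcal{V},\mathcal{E})\in R_V\}$ be the corresponding set of RCON models. Then $\mathcal{S}^{+}_{R_V}$ is a complete non-distributive lattice with respect to model inclusion (set inclusion). Its meet operation is induced by the meet operation of $\langle\mathcal{C}_V;\preceq\rangle$: for $\mathcal{G},\mathcal{H}\in R_V$, the meet of the models represented by $\mathcal{G}$ and $\mathcal{H}$ is the model represented by $\mathcal{G}\wedge\mathcal{H}$. The join of the models represented by $\mathcal{G},\mathcal{H}\in R_V$ is the model represented by $s_{R}(\mathcal{G}\vee\mathcal{H})$.
   Context: Graphs are undirected and simple. A coloured graph with vertex set $V$ is a pair $\mathcal{G}=(\mathcal{V},\mathcal{E})$ where $\mathcal{V}$ is a partition of $V$ (vertex colour classes) and $\mathcal{E}$ is a partition of the edge set $E$ of some graph $G=(V,E)$ (edge colour classes); $G$ is the underlying uncoloured graph. $\mathcal{C}_V$ is the set of all coloured graphs with vertex set $V$. For partitions $P_1,P_2$ of the same set, $P_1\le P_2$ means $P_1$ is finer than $P_2$ (every set in $P_2$ is a union of sets in $P_1$); $\wedge,\vee$ for partitions are the infimum and supremum for this order. Partial order on $\mathcal{C}_V$: for $\mathcal{G}=(\mathcal{V}_{\mathcal{G}},\mathcal{E}_{\mathcal{G}})$ and $\mathcal{H}=(\mathcal{V}_{\mathcal{H}},\mathcal{E}_{\mathcal{H}})$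 with edge sets $E_{\mathcal{G}},E_{\mathcal{H}}$, $\mathcal{G}\preceq\mathcal{H}$ iff (i) $E_{\mathcal{G}}\subseteq E_{\mathcal{H}}$, (ii) $\mathcal{V}_{\mathcal{G}}\ge\mathcal{V}_{\mathcal{H}}$, (iii) every class in $\mathcal{E}_{\mathcal{G}}$ is a union of classes in $\mathcal{E}_{\mathcal{H}}$. $\langle\mathcal{C}_V;\preceq\rangle$ is a complete lattice with $$\mathcal{G}\wedge\mathcal{H}=(\mathcal{V}_{\mathcal{G}}\vee\mathcal{V}_{\mathcal{H}},\ \mathcal{E}^{*}_{\mathcal{G}}\vee\mathcal{E}^{*}_{\mathcal{H}}),\qquad \mathcal{G}\vee\mathcal{H}=(\mathcal{V}_{\mathcal{G}}\wedge\mathcal{V}_{\mathcal{H}},\ \mathcal{E}^{**}_{\mathcal{G}}\wedge\mathcal{E}^{**}_{\mathcal{H}}),$$ where $\mathcal{E}^{*}_{\mathcal{G}}\subseteq\mathcal{E}_{\mathcal{G}}$ and $\mathcal{E}^{*}_{\mathcal{H}}\subseteq\mathcal{E}_{\mathcal{H}}$ are maximal with the property that they are partitions of the same subset of $E_{\mathcal{G}}\cap E_{\mathcal{H}}$, $\mathcal{E}^{**}_{\mathcal{G}}=\mathcal{E}_{\mathcal{G}}\cup\{E_{\mathcal{H}}\setminus E_{\mathcal{G}}\}$ and $\mathcal{E}^{**}_{\mathcal{H}}=\mathcal{E}_{\mathcal{H}}\cup\{E_{\mathcal{G}}\setminus E_{\mathcal{H}}\}$ (empty sets omitted). For $(\mathcal{V},\mathcal{E})\in\mathcal{C}_V$,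 the RCON model represented by it is identified with the set $\mathcal{S}^{+}(\mathcal{V},\mathcal{E})$ of symmetric positive definite real matrices $K=(k_{\alpha\beta})_{\alpha,\beta\in V}$ such that $k_{\alpha\beta}=0$ for $\alpha\ne\beta$ with $\alpha\beta\notin E$, $k_{\alpha\alpha}=k_{\beta\beta}$ whenever $\alpha,\beta$ lie in the same class of $\mathcal{V}$, and $k_{\alpha\beta}=k_{\gamma\delta}$ whenever the edges $\alpha\beta,\gamma\delta$ lie in the same class of $\mathcal{E}$. $(\mathcal{V},\mathcal{E})$ is regular if (i) every pair of equally coloured edges connects the same vertex colour classes, and (ii) every pair of equally coloured vertices has the same degree in every edge colour class. A partition $P$ of the vertex set of a graph $H$ is equitable with respect to $H$ if for all $v,w\in P$ and all $\alpha,\beta\in v$, $|\mathrm{ne}(\alpha)\cap w|=|\mathrm{ne}(\beta)\cap w|$, where $\mathrm{ne}$ denotes the set of neighbours in $H$. For every finite graph $H$ and partition $P$ of its vertex set there is a unique coarsest partition finer than $P$ and equitable with respect to $H$ (a known fact), denoted $r_H(P)$. The coloured factor graph of $\mathcal{G}=(\mathcal{V},\mathcal{E})\in\mathcal{C}_V$ is $\phi_V(\mathcal{G})=(\mathcal{V}\cup\mathcal{N},E_F)$: $N$ is a set of nodes, disjoint from $V$, one node for each edge in $E$; $\mathcal{N}$ is the partition of $N$ corresponding to $\mathcal{E}$; and $E_F=\{\alpha n: \alpha\in V,\ n\in N \text{ represents an edge incident with }\alpha\}$. The underlying uncoloured graph is $G_F=(V\cup N,E_F)$. The map $\phi_V$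 is a bijection onto the set of coloured factor graphs. Since $r_{G_F}(\mathcal{V}\cup\mathcal{N})$ refines $\mathcal{V}\cup\mathcal{N}$, it consists of a partition of $V$ and a partition of $N$, and one sets $s_R(\mathcal{G})=\phi_V^{-1}\big((r_{G_F}(\mathcal{V}\cup\mathcal{N}),E_F)\big)$, i.e. the coloured graph on $G$ given by these partitions of $V$ and of $E\cong N$. A lattice is distributive if $a\vee(b\wedge c)=(a\vee b)\wedge(a\vee c)$ for all $a,b,c$, and non-distributive otherwise.
   Formalization: Non-distributivity is claimed only when V has at least 3 elements; for |V| ≤ 2 the lattice is distributive (one element, or the four-element Boolean lattice), so the claim as stated for every finite V fails there. *)

theory Defs
  imports Complex_Main "HOL-Library.FuncSet" "HOL-Library.Disjoint_Sets"
    "HOL-Algebra.Complete_Lattice"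
begin

section \<open>Coloured graphs\<close>

text \<open>
  An edge is a two-element set of vertices. A coloured graph is a pair of its set of vertex colour
  classes and its set of edge colour classes. Since both are partitions into nonempty classes, the
  vertex set and the edge set are recovered as the unions of the classes.
\<close>

type_synonym 'a cgraph = "'a set set \<times> 'a set set set"

abbreviation vclasses :: "'a cgraph \<Rightarrow> 'a set set" where "vclasses \<equiv> fst"
abbreviation eclasses :: "'a cgraph \<Rightarrow> 'a set set set" where "eclasses \<equiv> snd"

definition edges :: "'a cgraph \<Rightarrow> 'a set set" where
  "edges G = \<Union>(eclasses G)"

definition coloured_graphs :: "'a set \<Rightarrow> 'a cgraph set" where
  "coloured_graphs V =
     {G. partition_on V (vclasses G) \<and> partition_on (edges G) (eclasses G) \<and>
         edges G \<subseteq> {e. e \<subseteq> V \<and> card e = 2}}"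

text \<open>
  In the library, \<open>refines V P Q\<close> means that the partition \<open>P\<close> of \<open>V\<close> is finer than \<open>Q\<close>. Hence a
  smaller coloured graph has fewer edges but a coarser colouring of the vertices.
\<close>

definition cg_le :: "'a set \<Rightarrow> 'a cgraph \<Rightarrow> 'a cgraph \<Rightarrow> bool" where
  "cg_le V G H \<longleftrightarrow>
     edges G \<subseteq> edges H \<and>
     refines V (vclasses H) (vclasses G) \<and>
     (\<forall>u\<in>eclasses G. \<exists>U\<subseteq>eclasses H. u = \<Union>U)"

text \<open>
  The meet and join of coloured graphs are the library's order-theoretic \<open>\<sqinter>\<close> and \<open>\<squnion>\<close> (greatest lower and
  least upper bound) of this order.
\<close>

definition cg_order :: "'a set \<Rightarrow> 'a cgraph gorder" where
  "cg_order V = \<lparr>carrier = coloured_graphs V, eq = (=), le = cg_le V\<rparr>"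

definition regular :: "'a cgraph \<Rightarrow> bool" where
  "regular G \<longleftrightarrow>
     (\<forall>u\<in>eclasses G. \<forall>e\<in>u. \<forall>f\<in>u.
        {v \<in> vclasses G. v \<inter> e \<noteq> {}} = {v \<in> vclasses G. v \<inter> f \<noteq> {}}) \<and>
     (\<forall>v\<in>vclasses G. \<forall>\<alpha>\<in>v. \<forall>\<beta>\<in>v. \<forall>u\<in>eclasses G.
        card {e \<in> u. \<alpha> \<in> e} = card {e \<in> u. \<beta> \<in> e})"

definition regular_graphs :: "'a set \<Rightarrow> 'a cgraph set" where
  "regular_graphs V = {G \<in> coloured_graphs V. regular G}"


section \<open>RCON models\<close>

text \<open>
  A matrix indexed by \<open>V\<close> is a function on \<open>V \<times> V\<close>, represented extensionally so that equality of
  functions is equality of matrices.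
\<close>

definition sym_pos_def :: "'a set \<Rightarrow> ('a \<times> 'a \<Rightarrow> real) set" where
  "sym_pos_def V =
     {K \<in> extensional (V \<times> V).
        (\<forall>\<alpha>\<in>V. \<forall>\<beta>\<in>V. K (\<alpha>, \<beta>) = K (\<beta>, \<alpha>)) \<and>
        (\<forall>x. (\<exists>\<alpha>\<in>V. x \<alpha> \<noteq> 0) \<longrightarrow> (\<Sum>\<alpha>\<in>V. \<Sum>\<beta>\<in>V. x \<alpha> * K (\<alpha>, \<beta>) * x \<beta>) > 0)}"

definition rcon_model :: "'a set \<Rightarrow> 'a cgraph \<Rightarrow> ('a \<times> 'a \<Rightarrow> real) set" where
  "rcon_model V G =
     {K \<in> sym_pos_def V.
        (\<forall>\<alpha>\<in>V. \<forall>\<beta>\<in>V. \<alpha> \<noteq> \<beta> \<and> {\<alpha>, \<beta>} \<notin> edges G \<longrightarrow> K (\<alpha>, \<beta>) = 0) \<and>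
        (\<forall>v\<in>vclasses G. \<forall>\<alpha>\<in>v. \<forall>\<beta>\<in>v. K (\<alpha>, \<alpha>) = K (\<beta>, \<beta>)) \<and>
        (\<forall>u\<in>eclasses G. \<forall>\<alpha> \<beta> \<gamma> \<delta>. {\<alpha>, \<beta>} \<in> u \<and> {\<gamma>, \<delta>} \<in> u \<longrightarrow> K (\<alpha>, \<beta>) = K (\<gamma>, \<delta>))}"

definition regular_models :: "'a set \<Rightarrow> ('a \<times> 'a \<Rightarrow> real) set set" where
  "regular_models V = rcon_model V ` regular_graphs V"

definition regular_model_order :: "'a set \<Rightarrow> ('a \<times> 'a \<Rightarrow> real) set gorder" where
  "regular_model_order V = \<lparr>carrier = regular_models V, eq = (=), le = (\<subseteq>)\<rparr>"


section \<open>Coarsest equitable refinements and factor graphs\<close>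

definition neighbours :: "'b set set \<Rightarrow> 'b \<Rightarrow> 'b set" where
  "neighbours E \<alpha> = {\<beta>. {\<alpha>, \<beta>} \<in> E}"

definition equitable :: "'b set set \<Rightarrow> 'b set set \<Rightarrow> bool" where
  "equitable E P \<longleftrightarrow>
     (\<forall>v\<in>P. \<forall>w\<in>P. \<forall>\<alpha>\<in>v. \<forall>\<beta>\<in>v.
        card (neighbours E \<alpha> \<inter> w) = card (neighbours E \<beta> \<inter> w))"

text \<open>The graph has vertex set \<open>W\<close> and edge set \<open>E\<close>.\<close>

definition coarsest_equitable :: "'b set \<Rightarrow> 'b set set \<Rightarrow> 'b set set \<Rightarrow> 'b set set" where
  "coarsest_equitable W E P =
     (THE R. refines W R P \<and> equitable E R \<and>
             (\<forall>Q. refines W Q P \<and> equitable E Q \<longrightarrow> refines W Q R))"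

text \<open>
  The factor node of an edge \<open>e\<close> is \<open>Inr e\<close>, which makes the factor nodes disjoint from the
  vertices \<open>Inl \<alpha>\<close>.
\<close>

definition factor_nodes :: "'a set \<Rightarrow> 'a cgraph \<Rightarrow> ('a + 'a set) set" where
  "factor_nodes V G = Inl ` V \<union> Inr ` edges G"

definition factor_colouring :: "'a cgraph \<Rightarrow> ('a + 'a set) set set" where
  "factor_colouring G = (`) Inl ` vclasses G \<union> (`) Inr ` eclasses G"

definition factor_edges :: "'a set \<Rightarrow> 'a cgraph \<Rightarrow> ('a + 'a set) set set" where
  "factor_edges V G = {{Inl \<alpha>, Inr e} | \<alpha> e. \<alpha> \<in> V \<and> e \<in> edges G \<and> \<alpha> \<in> e}"

definition coloured_factor_graph ::
    "'a set \<Rightarrow> 'a cgraph \<Rightarrow> ('a + 'a set) set set \<times> ('a + 'a set) set set" where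
  "coloured_factor_graph V G = (factor_colouring G, factor_edges V G)"

definition s_R :: "'a set \<Rightarrow> 'a cgraph \<Rightarrow> 'a cgraph" where
  "s_R V G =
     inv_into (coloured_graphs V) (coloured_factor_graph V)
       (coarsest_equitable (factor_nodes V G) (factor_edges V G) (factor_colouring G),
        factor_edges V G)"


section \<open>Distributivity\<close>

definition distributive :: "('a, 'b) gorder_scheme \<Rightarrow> bool" where
  "distributive L \<longleftrightarrow>
     (\<forall>a\<in>carrier L. \<forall>b\<in>carrier L. \<forall>c\<in>carrier L.
        a \<squnion>\<^bsub>L\<^esub> (b \<sqinter>\<^bsub>L\<^esub> c) = (a \<squnion>\<^bsub>L\<^esub> b) \<sqinter>\<^bsub>L\<^esub> (a \<squnion>\<^bsub>L\<^esub> c))"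

end

theory Submission
  imports Defs
begin

text \<open>
  A model contains a matrix whose entries differ whenever the colouring allows it, and whose large
  diagonal makes it positive definite; hence inclusion of models is the order of coloured graphs.
  Regularity is equitability of the factor graph and is inherited by infima of arbitrary families:
  a class of the infimum is a union of classes of each member of the family, so endpoint and degree
  conditions can be checked along chains of vertices or edges equally coloured in some member. This
  gives the complete lattice and its meet. If a regular graph lies above \<open>G\<close>, so does its restriction
  to the edges of \<open>G\<close>, which is again regular; therefore the coarsest regular refinement of \<open>G\<close> on the
  same edges is the least regular graph above \<open>G\<close>, which gives the join.
\<close>

section \<open>Partitions as equivalence relations\<close>

text \<open>Passing from a partition to its relation \<open>same_class\<close> turns "is a union of
  classes" into an implication about pairs, and the supremum of partitions into a reflexive
  transitive closure; the chain arguments then become inductions over this closure. Regularity is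
  not inherited by joins, which is why \<open>s_R\<close> enters. Take a triangle on 1, 2, 3 with
  one vertex and one edge colour, and the edgeless graph with vertex classes {1} and {2, 3}. Both
  are regular, but their join still colours all three edges alike, although 12 and 23 no longer meet
  the same vertex classes. The colouring \<open>s_R\<close> is optimal only among graphs with the
  same edges, whereas a join competes with graphs that have more edges; restriction closes this gap.
  The coarsest equitable refinement is not assumed to exist: it is obtained from an infimum of
  regular graphs. Non-distributivity is claimed from three vertices on. On two vertices every
  coloured graph is regular and the order is a product of two chains (edge present or not, vertices
  coloured alike or not), hence distributive; on fewer vertices there is only one graph.\<close>

definition same_class :: "'b set set \<Rightarrow> ('b \<times> 'b) set" where
  "same_class P = {(x, y). \<exists>p\<in>P. x \<in> p \<and> y \<in> p}"

lemma equiv_same_class: "partition_on A P \<Longrightarrow> equiv A (same_class P)"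
  unfolding same_class_def by (rule equiv_partition_on)

lemma quotient_same_class: "partition_on A P \<Longrightarrow> A // same_class P = P"
  unfolding same_class_def by (rule partition_on_eq_quotient)

lemma sym_same_class: "sym (same_class P)"
  by (auto simp: same_class_def sym_def)

lemma same_class_quotient:
  assumes "equiv A r"
  shows "same_class (A // r) = r"
proof -
  have "(x, y) \<in> r" if "p \<in> A // r" "x \<in> p" "y \<in> p" for p x y
    using quotient_eq_iff[OF assms that(1,1,2,3)] by simp
  moreover have "\<exists>p\<in>A // r. x \<in> p \<and> y \<in> p" if "(x, y) \<in> r" for x y
  proof
    have "x \<in> A"
      using that assms by (auto simp: equiv_def)
    then show "r `` {x} \<in> A // r" "x \<in> r `` {x} \<and> y \<in> r `` {x}"
      using that \<open>x \<in> A\<close> assms by (auto simp: quotientI equiv_def refl_on_def)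
  qed
  ultimately show ?thesis
    by (auto simp: same_class_def)
qed

lemma same_class_inject:
  "\<lbrakk>partition_on A P; partition_on A Q; same_class P = same_class Q\<rbrakk> \<Longrightarrow> P = Q"
  by (metis quotient_same_class)

lemma partition_on_class_unique:
  "\<lbrakk>partition_on A P; p \<in> P; q \<in> P; x \<in> p; x \<in> q\<rbrakk> \<Longrightarrow> p = q"
  by (metis disjointD disjoint_iff partition_onD2)

lemma class_closed:
  "\<lbrakk>partition_on A P; p \<in> P; x \<in> p; (x, y) \<in> same_class P\<rbrakk> \<Longrightarrow> y \<in> p"
  using partition_on_class_unique by (fastforce simp: same_class_def)

lemma refines_iff_same_class:
  assumes "partition_on A P" "partition_on A Q"
  shows "refines A P Q \<longleftrightarrow> same_class P \<subseteq> same_class Q"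
proof
  assume "refines A P Q"
  then show "same_class P \<subseteq> same_class Q"
    unfolding refines_def same_class_def by blast
next
  assume sub: "same_class P \<subseteq> same_class Q"
  have "\<exists>q\<in>Q. p \<subseteq> q" if p: "p \<in> P" for p
  proof -
    obtain x where x: "x \<in> p"
      using p partition_onD3[OF assms(1)] by (metis ex_in_conv)
    then have "x \<in> A"
      using p partition_onD1[OF assms(1)] by blast
    then obtain q where q: "q \<in> Q" "x \<in> q"
      using partition_onD1[OF assms(2)] by blast
    have "y \<in> q" if "y \<in> p" for y
    proof -
      have "(x, y) \<in> same_class P"
        using p x that by (auto simp: same_class_def)
      then show ?thesis
        using class_closed[OF assms(2) q] sub by blast
    qed
    then show ?thesis
      using q by blast
  qed
  then show "refines A P Q"
    using assms by (simp add: refines_def)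
qed

text \<open>The closure is reflexive on the whole type, hence the cut to \<open>A\<close>.
  Transitivity survives the cut because only the two ends of a chain are tested for membership in
  \<open>A\<close>.\<close>

lemma equiv_rtrancl_Int:
  assumes "sym r"
  shows "equiv A (r\<^sup>* \<inter> A \<times> A)"
proof (rule equivI)
  show "refl_on A (r\<^sup>* \<inter> A \<times> A)"
    by (rule refl_onI) simp
  show "sym (r\<^sup>* \<inter> A \<times> A)"
    using symD[OF sym_rtrancl[OF assms]] by (intro symI) blast
  show "trans (r\<^sup>* \<inter> A \<times> A)"
    by (intro transI) (blast intro: rtrancl_trans)
qed blast


section \<open>The lattice of coloured graphs\<close>

abbreviation vertex_rel :: "'a cgraph \<Rightarrow> ('a \<times> 'a) set" where
  "vertex_rel G \<equiv> same_class (vclasses G)"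

abbreviation edge_rel :: "'a cgraph \<Rightarrow> ('a set \<times> 'a set) set" where
  "edge_rel G \<equiv> same_class (eclasses G)"

lemma coloured_graphsD:
  assumes "G \<in> coloured_graphs V"
  shows "partition_on V (vclasses G)" "partition_on (edges G) (eclasses G)"
    "\<And>e. e \<in> edges G \<Longrightarrow> e \<subseteq> V" "\<And>e. e \<in> edges G \<Longrightarrow> card e = 2"
    "equiv V (vertex_rel G)" "equiv (edges G) (edge_rel G)"
  using assms by (auto simp: coloured_graphs_def equiv_same_class)

lemma coloured_graphsI:
  assumes "partition_on V (vclasses G)" "partition_on (edges G) (eclasses G)"
    and "\<And>e. e \<in> edges G \<Longrightarrow> e \<subseteq> V" "\<And>e. e \<in> edges G \<Longrightarrow> card e = 2"
  shows "G \<in> coloured_graphs V"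
  unfolding coloured_graphs_def using assms by blast

lemma finite_edges:
  assumes "finite V" "G \<in> coloured_graphs V"
  shows "finite (edges G)"
  using assms finite_subset[of "edges G" "Pow V"] coloured_graphsD(3)[OF assms(2)] by auto

lemma edge_rel_Field: "(e, f) \<in> edge_rel G \<Longrightarrow> e \<in> edges G \<and> f \<in> edges G"
  by (auto simp: same_class_def edges_def)

lemma edge_rel_refl: "e \<in> edges G \<Longrightarrow> (e, e) \<in> edge_rel G"
  by (auto simp: same_class_def edges_def)

lemma vertex_rel_Field:
  "\<lbrakk>G \<in> coloured_graphs V; (x, y) \<in> vertex_rel G\<rbrakk> \<Longrightarrow> x \<in> V \<and> y \<in> V"
  using coloured_graphsD(1) partition_onD1 by (fastforce simp: same_class_def)

lemma vertex_rel_refl: "\<lbrakk>G \<in> coloured_graphs V; x \<in> V\<rbrakk> \<Longrightarrow> (x, x) \<in> vertex_rel G"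
  by (meson coloured_graphsD(5) equivE refl_onD)

text \<open>Only \<open>e\<close> is required to be an edge of \<open>G\<close>; the conclusion
  forces \<open>f\<close> to be one too. So the third clause says that an edge class of
  \<open>H\<close> that meets \<open>edges G\<close> lies inside a single class of
  \<open>G\<close>.\<close>

lemma cg_le_iff:
  assumes G: "G \<in> coloured_graphs V" and H: "H \<in> coloured_graphs V"
  shows "cg_le V G H \<longleftrightarrow>
    edges G \<subseteq> edges H \<and> vertex_rel H \<subseteq> vertex_rel G \<and>
    (\<forall>e f. e \<in> edges G \<longrightarrow> (e, f) \<in> edge_rel H \<longrightarrow> (e, f) \<in> edge_rel G)"
proof -
  have "(\<forall>u\<in>eclasses G. \<exists>U\<subseteq>eclasses H. u = \<Union>U) \<longleftrightarrow>
    (\<forall>e f. e \<in> edges G \<longrightarrow> (e, f) \<in> edge_rel H \<longrightarrow> (e, f) \<in> edge_rel G)"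
    (is "?L \<longleftrightarrow> ?R") if sub: "edges G \<subseteq> edges H"
  proof
    assume L: ?L
    show ?R
    proof (intro allI impI)
      fix e f assume "e \<in> edges G" and ef: "(e, f) \<in> edge_rel H"
      then obtain u where u: "u \<in> eclasses G" "e \<in> u"
        by (auto simp: edges_def)
      then obtain U where U: "U \<subseteq> eclasses H" "u = \<Union>U"
        using L by blast
      then obtain w where w: "w \<in> U" "e \<in> w"
        using u by blast
      have "f \<in> w"
        using class_closed[OF coloured_graphsD(2)[OF H] subsetD[OF U(1) w(1)] w(2) ef] .
      then show "(e, f) \<in> edge_rel G"
        using u(1) U(2) w unfolding same_class_def by blast
    qed
  next
    assume R: ?R
    show ?L
    proof
      fix u assume u: "u \<in> eclasses G"
      \<comment> \<open>The only possible choice: classes of \<open>H\<close> are disjoint and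
        nonempty, so those that make up \<open>u\<close> are exactly those contained in it.\<close>
      define U where "U = {w \<in> eclasses H. w \<subseteq> u}"
      have "\<exists>w\<in>U. e \<in> w" if e: "e \<in> u" for e
      proof -
        have eG: "e \<in> edges G"
          using e u by (auto simp: edges_def)
        then obtain w where w: "w \<in> eclasses H" "e \<in> w"
          using sub by (auto simp: edges_def)
        have "f \<in> u" if "f \<in> w" for f
        proof -
          have "(e, f) \<in> edge_rel H"
            using w that unfolding same_class_def by blast
          then show ?thesis
            using class_closed[OF coloured_graphsD(2)[OF G] u e] R eG by blast
        qed
        then show ?thesis
          using w unfolding U_def by blast
      qed
      then have "u = \<Union>U"
        unfolding U_def by blast
      moreover have "U \<subseteq> eclasses H"
        unfolding U_def by blast
      ultimately show "\<exists>U\<subseteq>eclasses H. u = \<Union>U"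
        by blast
    qed
  qed
  then show ?thesis
    unfolding cg_le_def
      refines_iff_same_class[OF coloured_graphsD(1)[OF H] coloured_graphsD(1)[OF G]]
    by metis
qed

lemma cg_leD:
  assumes "cg_le V G H" "G \<in> coloured_graphs V" "H \<in> coloured_graphs V"
  shows "edges G \<subseteq> edges H" "vertex_rel H \<subseteq> vertex_rel G"
    "\<And>e f. \<lbrakk>e \<in> edges G; (e, f) \<in> edge_rel H\<rbrakk> \<Longrightarrow> (e, f) \<in> edge_rel G"
  using iffD1[OF cg_le_iff[OF assms(2,3)] assms(1)] by blast+

lemma cg_le_refl: "G \<in> coloured_graphs V \<Longrightarrow> cg_le V G G"
  by (simp add: cg_le_iff)

lemma cg_le_antisym:
  assumes G: "G \<in> coloured_graphs V" and H: "H \<in> coloured_graphs V"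
    and le: "cg_le V G H" "cg_le V H G"
  shows "G = H"
proof -
  note D = cg_leD[OF le(1) G H] cg_leD[OF le(2) H G]
  have E: "edges G = edges H" and V: "vertex_rel G = vertex_rel H"
    using D(1,2,4,5) by blast+
  have "edge_rel G = edge_rel H"
    using D(3,6) E edge_rel_Field by (metis (no_types, lifting) subrelI subset_antisym)
  then have "eclasses G = eclasses H"
    using coloured_graphsD(2)[OF G] coloured_graphsD(2)[OF H] E same_class_inject by metis
  moreover have "vclasses G = vclasses H"
    using coloured_graphsD(1)[OF G] coloured_graphsD(1)[OF H] V same_class_inject by metis
  ultimately show ?thesis
    by (simp add: prod_eq_iff)
qed

lemma cg_le_trans:
  assumes "G \<in> coloured_graphs V" "H \<in> coloured_graphs V" "K \<in> coloured_graphs V"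
    and "cg_le V G H" "cg_le V H K"
  shows "cg_le V G K"
  using cg_leD[OF assms(4,1,2)] cg_leD[OF assms(5,2,3)]
  by (intro iffD2[OF cg_le_iff[OF assms(1,3)]] conjI allI impI) blast+

text \<open>
  An edge belongs to the infimum iff the class generated by it in the join of all edge colourings
  consists of common edges. For the empty family this gives the complete graph with all colour
  classes singletons.
\<close>

definition cg_Inf :: "'a set \<Rightarrow> 'a cgraph set \<Rightarrow> 'a cgraph" where
  "cg_Inf V A =
     (let R = (\<Union>G\<in>A. edge_rel G)\<^sup>*;
          F = {e. e \<subseteq> V \<and> card e = 2 \<and> (\<forall>f. (e, f) \<in> R \<longrightarrow> (\<forall>G\<in>A. f \<in> edges G))}
      in (V // ((\<Union>G\<in>A. vertex_rel G)\<^sup>* \<inter> V \<times> V), F // (R \<inter> F \<times> F)))"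

lemma sym_UN_same_class: "sym (\<Union>G\<in>A. same_class (g G))"
  by (auto simp: same_class_def sym_def)

lemma
  shows vertex_rel_cg_Inf: "vertex_rel (cg_Inf V A) = (\<Union>G\<in>A. vertex_rel G)\<^sup>* \<inter> V \<times> V"
    and edges_cg_Inf: "edges (cg_Inf V A) = {e. e \<subseteq> V \<and> card e = 2 \<and>
      (\<forall>f. (e, f) \<in> (\<Union>G\<in>A. edge_rel G)\<^sup>* \<longrightarrow> (\<forall>G\<in>A. f \<in> edges G))}"
    and edge_rel_cg_Inf: "edge_rel (cg_Inf V A) =
      (\<Union>G\<in>A. edge_rel G)\<^sup>* \<inter> edges (cg_Inf V A) \<times> edges (cg_Inf V A)"
    and cg_Inf_coloured: "cg_Inf V A \<in> coloured_graphs V"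
proof -
  define R where "R = (\<Union>G\<in>A. edge_rel G)\<^sup>*"
  define F where "F = {e. e \<subseteq> V \<and> card e = 2 \<and> (\<forall>f. (e, f) \<in> R \<longrightarrow> (\<forall>G\<in>A. f \<in> edges G))}"
  have inf: "cg_Inf V A = (V // ((\<Union>G\<in>A. vertex_rel G)\<^sup>* \<inter> V \<times> V), F // (R \<inter> F \<times> F))"
    by (simp add: cg_Inf_def Let_def R_def F_def)
  have eqR: "equiv F (R \<inter> F \<times> F)"
    unfolding R_def by (rule equiv_rtrancl_Int[OF sym_UN_same_class])
  have eqV: "equiv V ((\<Union>G\<in>A. vertex_rel G)\<^sup>* \<inter> V \<times> V)"
    by (rule equiv_rtrancl_Int[OF sym_UN_same_class])
  show "vertex_rel (cg_Inf V A) = (\<Union>G\<in>A. vertex_rel G)\<^sup>* \<inter> V \<times> V"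
    by (simp add: inf same_class_quotient[OF eqV])
  have E: "edges (cg_Inf V A) = F"
    using Union_quotient[OF eqR] by (simp add: inf edges_def)
  then show "edges (cg_Inf V A) = {e. e \<subseteq> V \<and> card e = 2 \<and>
      (\<forall>f. (e, f) \<in> (\<Union>G\<in>A. edge_rel G)\<^sup>* \<longrightarrow> (\<forall>G\<in>A. f \<in> edges G))}"
    by (simp add: F_def R_def)
  show "edge_rel (cg_Inf V A) =
      (\<Union>G\<in>A. edge_rel G)\<^sup>* \<inter> edges (cg_Inf V A) \<times> edges (cg_Inf V A)"
    unfolding E by (simp add: inf same_class_quotient[OF eqR] flip: R_def)
  have "F \<subseteq> {e. e \<subseteq> V \<and> card e = 2}"
    by (auto simp: F_def)
  then show "cg_Inf V A \<in> coloured_graphs V"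
    using partition_on_quotient[OF eqV] partition_on_quotient[OF eqR] E
    by (simp add: coloured_graphs_def inf)
qed

text \<open>The quantifier over all reachable \<open>f\<close> in \<open>cg_Inf\<close> selects
  edges in whole closure classes, so cutting the closure down to these edges breaks no chain that
  starts in one of them.\<close>

lemma edges_cg_Inf_closed:
  assumes "e \<in> edges (cg_Inf V A)" "(e, f) \<in> (\<Union>G\<in>A. edge_rel G)\<^sup>*" "A \<subseteq> coloured_graphs V"
  shows "f \<in> edges (cg_Inf V A)"
proof -
  have "f \<subseteq> V \<and> card f = 2"
  \<comment> \<open>In a nonempty family any member guarantees that \<open>f\<close> is an edge on
    \<open>V\<close>; for the empty family the closure is the identity and \<open>f\<close> equals
    \<open>e\<close>.\<close>
  proof (cases "A = {}")
    case False
    then obtain G where "G \<in> A"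
      by blast
    then have "f \<in> edges G" "G \<in> coloured_graphs V"
      using assms by (auto simp: edges_cg_Inf)
    then show ?thesis
      using coloured_graphsD by blast
  qed (use assms in \<open>simp add: edges_cg_Inf\<close>)
  moreover have "g \<in> edges G" if "(f, g) \<in> (\<Union>G\<in>A. edge_rel G)\<^sup>*" "G \<in> A" for g G
    using assms(1) rtrancl_trans[OF assms(2) that(1)] that(2) unfolding edges_cg_Inf by blast
  ultimately show ?thesis
    by (simp add: edges_cg_Inf)
qed

lemma cg_Inf_lower:
  assumes A: "A \<subseteq> coloured_graphs V" and G: "G \<in> A"
  shows "cg_le V (cg_Inf V A) G"
proof -
  have G': "G \<in> coloured_graphs V"
    using A G by blast
  have "edges (cg_Inf V A) \<subseteq> edges G"
    using G by (auto simp: edges_cg_Inf)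
  moreover have "vertex_rel G \<subseteq> vertex_rel (cg_Inf V A)"
  proof -
    have "vertex_rel G \<subseteq> (\<Union>G\<in>A. vertex_rel G)\<^sup>*"
      using G by blast
    then show ?thesis
      using vertex_rel_Field[OF G'] by (auto simp: vertex_rel_cg_Inf)
  qed
  moreover have "(e, f) \<in> edge_rel (cg_Inf V A)"
    if e: "e \<in> edges (cg_Inf V A)" and ef: "(e, f) \<in> edge_rel G" for e f
  proof -
    have "(e, f) \<in> (\<Union>G\<in>A. edge_rel G)\<^sup>*"
      using G ef by blast
    then show ?thesis
      using e edges_cg_Inf_closed[OF e _ A] by (simp add: edge_rel_cg_Inf)
  qed
  ultimately show ?thesis
    by (simp add: cg_le_iff[OF cg_Inf_coloured G'])
qed

lemma cg_Inf_greatest: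
  assumes A: "A \<subseteq> coloured_graphs V" and X: "X \<in> coloured_graphs V"
    and le: "\<And>G. G \<in> A \<Longrightarrow> cg_le V X G"
  shows "cg_le V X (cg_Inf V A)"
proof -
  have le': "edges X \<subseteq> edges G" "vertex_rel G \<subseteq> vertex_rel X"
    "\<And>e f. \<lbrakk>e \<in> edges X; (e, f) \<in> edge_rel G\<rbrakk> \<Longrightarrow> (e, f) \<in> edge_rel X" if "G \<in> A" for G
    using cg_leD[OF le[OF that] X] A that by blast+
  \<comment> \<open>Each link lies in some \<open>G\<close> above \<open>X\<close>, and the third
    clause of the order yields equal colour in \<open>X\<close> and with it membership of the next
    edge, so the chain never leaves \<open>edges X\<close>.\<close>
  have edge: "(e, f) \<in> edge_rel X" if "e \<in> edges X" "(e, f) \<in> (\<Union>G\<in>A. edge_rel G)\<^sup>*" for e f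
    using that(2)
  proof induction
    case (step f g)
    then obtain G where "G \<in> A" "(f, g) \<in> edge_rel G"
      by blast
    with step have "(f, g) \<in> edge_rel X"
      using le'(3) edge_rel_Field by blast
    with step show ?case
      using coloured_graphsD(6)[OF X] by (meson equivE transE)
  qed (use that(1) in \<open>simp add: edge_rel_refl\<close>)
  have vertex: "(x, y) \<in> vertex_rel X" if "x \<in> V" "(x, y) \<in> (\<Union>G\<in>A. vertex_rel G)\<^sup>*" for x y
    using that(2)
  proof induction
    case (step y z)
    then have "(y, z) \<in> vertex_rel X"
      using le'(2) by blast
    with step show ?case
      using coloured_graphsD(5)[OF X] by (meson equivE transE)
  qed (use that(1) in \<open>simp add: vertex_rel_refl[OF X]\<close>)
  have "edges X \<subseteq> edges (cg_Inf V A)"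
    using edge edge_rel_Field[of _ _ X] le'(1) coloured_graphsD(3,4)[OF X]
    unfolding edges_cg_Inf by blast
  moreover have "vertex_rel (cg_Inf V A) \<subseteq> vertex_rel X"
    using vertex by (auto simp: vertex_rel_cg_Inf)
  ultimately show ?thesis
    using edge by (simp add: cg_le_iff[OF X cg_Inf_coloured] edge_rel_cg_Inf)
qed

section \<open>Completeness of the order on coloured graphs\<close>

lemma cg_order_simps [simp]:
  "carrier (cg_order V) = coloured_graphs V"
  "le (cg_order V) = cg_le V" "eq (cg_order V) = (=)"
  by (auto simp: cg_order_def)

lemma partial_order_cg_order: "partial_order (cg_order V)"
proof unfold_locales
  show "x .=\<^bsub>cg_order V\<^esub> y"
    if "x \<sqsubseteq>\<^bsub>cg_order V\<^esub> y" "y \<sqsubseteq>\<^bsub>cg_order V\<^esub> x"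
      "x \<in> carrier (cg_order V)" "y \<in> carrier (cg_order V)" for x y
    using cg_le_antisym[of x V y] that by simp
  show "x \<sqsubseteq>\<^bsub>cg_order V\<^esub> z"
    if "x \<sqsubseteq>\<^bsub>cg_order V\<^esub> y" "y \<sqsubseteq>\<^bsub>cg_order V\<^esub> z" "x \<in> carrier (cg_order V)"
      "y \<in> carrier (cg_order V)" "z \<in> carrier (cg_order V)" for x y z
    using cg_le_trans[of x V y z] that by simp
qed (simp_all add: cg_le_refl)

lemma greatest_cg_Inf:
  assumes A: "A \<subseteq> coloured_graphs V"
  shows "greatest (cg_order V) (cg_Inf V A) (Lower (cg_order V) A)"
proof (rule greatest_LowerI)
  fix G assume "G \<in> Lower (cg_order V) A"
  then have "G \<in> coloured_graphs V" "\<And>H. H \<in> A \<Longrightarrow> cg_le V G H"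
    using Lower_memD[of G "cg_order V" A] subsetD[OF Lower_closed, of G "cg_order V" A] A
    by simp_all
  then show "G \<sqsubseteq>\<^bsub>cg_order V\<^esub> cg_Inf V A"
    using cg_Inf_greatest[OF A] by simp
qed (simp_all add: A cg_Inf_lower cg_Inf_coloured)

text \<open>Infima of all families suffice; the top is the infimum of the empty family, of which
  every element is a lower bound.\<close>

lemma complete_lattice_cg_order: "complete_lattice (cg_order V)"
proof (rule partial_order.complete_lattice_criterion1[OF partial_order_cg_order])
  show "\<exists>G. greatest (cg_order V) G (carrier (cg_order V))"
    using greatest_cg_Inf[of "{}" V] by (metis Lower_empty empty_subsetI)
  show "\<exists>G. greatest (cg_order V) G (Lower (cg_order V) A)" if "A \<subseteq> carrier (cg_order V)" for A
    using greatest_cg_Inf[of A V] that unfolding cg_order_simps by blast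
qed


section \<open>Regular colourings\<close>

text \<open>The endpoint condition in a form that can be iterated: an endpoint is carried from one
  edge to the next along a chain.\<close>

lemma regular_edge_rel:
  assumes G: "G \<in> coloured_graphs V" and reg: "regular G"
    and ef: "(e, f) \<in> edge_rel G" and x: "x \<in> e"
  shows "\<exists>y\<in>f. (x, y) \<in> vertex_rel G"
proof -
  obtain u where u: "u \<in> eclasses G" "e \<in> u" "f \<in> u"
    using ef by (auto simp: same_class_def)
  then have "e \<in> edges G"
    by (auto simp: edges_def)
  then have "x \<in> V"
    using coloured_graphsD(3)[OF G] x by blast
  then obtain v where v: "v \<in> vclasses G" "x \<in> v"
    using partition_onD1[OF coloured_graphsD(1)[OF G]] by blast
  have "{v \<in> vclasses G. v \<inter> e \<noteq> {}} = {v \<in> vclasses G. v \<inter> f \<noteq> {}}"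
    using reg u unfolding regular_def by blast
  then obtain y where "y \<in> v" "y \<in> f"
    using v x by blast
  then show ?thesis
    using v by (auto simp: same_class_def)
qed

text \<open>Such a set \<open>U\<close> is a disjoint union of edge classes, and the degree of a
  vertex in \<open>U\<close> is the sum of its degrees in these classes. Needed because an edge
  class of an infimum is a union of classes of each member, but in general not a class of
  any.\<close>

lemma regular_degree_closed:
  assumes V: "finite V" and G: "G \<in> coloured_graphs V" and reg: "regular G"
    and xy: "(x, y) \<in> vertex_rel G"
    and U: "U \<subseteq> edges G" "\<And>e f. \<lbrakk>e \<in> U; (e, f) \<in> edge_rel G\<rbrakk> \<Longrightarrow> f \<in> U"
  shows "card {e \<in> U. x \<in> e} = card {e \<in> U. y \<in> e}"
proof -
  let ?C = "{u \<in> eclasses G. u \<subseteq> U}"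
  have fin: "finite (edges G)"
    by (rule finite_edges[OF V G])
  then have finC: "finite ?C"
    using finite_elements[OF fin coloured_graphsD(2)[OF G]] by simp
  have "card {e \<in> U. z \<in> e} = (\<Sum>u\<in>?C. card {e \<in> u. z \<in> e})" for z
  proof -
    have "{e \<in> U. z \<in> e} = (\<Union>u\<in>?C. {e \<in> u. z \<in> e})"
    proof -
      have "\<exists>u\<in>?C. e \<in> u" if e: "e \<in> U" for e
      proof -
        obtain u where u: "u \<in> eclasses G" "e \<in> u"
          using e U(1) by (auto simp: edges_def)
        have "f \<in> U" if "f \<in> u" for f
          using U(2)[OF e] u that unfolding same_class_def by blast
        then show ?thesis
          using u by blast
      qed
      then show ?thesis
        by blast
    qed
    also have "card \<dots> = (\<Sum>u\<in>?C. card {e \<in> u. z \<in> e})"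
    proof (rule card_UN_disjoint[OF finC])
      show "\<forall>u\<in>?C. finite {e \<in> u. z \<in> e}"
        using finite_subset[OF U(1) fin] by (auto intro: finite_subset)
      show "\<forall>u\<in>?C. \<forall>w\<in>?C. u \<noteq> w \<longrightarrow> {e \<in> u. z \<in> e} \<inter> {e \<in> w. z \<in> e} = {}"
        using partition_on_class_unique[OF coloured_graphsD(2)[OF G]] by blast
    qed
    finally show ?thesis .
  qed
  moreover have "card {e \<in> u. x \<in> e} = card {e \<in> u. y \<in> e}" if "u \<in> ?C" for u
  proof -
    obtain v where "v \<in> vclasses G" "x \<in> v" "y \<in> v"
      using xy by (auto simp: same_class_def)
    then show ?thesis
      using reg that unfolding regular_def by blast
  qed
  ultimately show ?thesis
    by simp
qed

lemma regular_graphsD: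
  "G \<in> regular_graphs V \<Longrightarrow> G \<in> coloured_graphs V" "G \<in> regular_graphs V \<Longrightarrow> regular G"
  by (simp_all add: regular_graphs_def)

text \<open>Carrying endpoints from \<open>e\<close> to \<open>f\<close> suffices, since exchanging
  the two edges gives the other inclusion between the sets of classes they meet.\<close>

lemma regularI:
  assumes G: "G \<in> coloured_graphs V"
    and edge: "\<And>e f x. \<lbrakk>(e, f) \<in> edge_rel G; x \<in> e\<rbrakk> \<Longrightarrow> \<exists>y\<in>f. (x, y) \<in> vertex_rel G"
    and degree: "\<And>u x y. \<lbrakk>u \<in> eclasses G; (x, y) \<in> vertex_rel G\<rbrakk> \<Longrightarrow>
      card {e \<in> u. x \<in> e} = card {e \<in> u. y \<in> e}"
  shows "regular G"
proof -
  have "{v \<in> vclasses G. v \<inter> e \<noteq> {}} \<subseteq> {v \<in> vclasses G. v \<inter> f \<noteq> {}}"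
    if "u \<in> eclasses G" "e \<in> u" "f \<in> u" for u e f
  proof clarify
    fix v assume v: "v \<in> vclasses G" "v \<inter> e \<noteq> {}" "v \<inter> f = {}"
    then obtain x where x: "x \<in> v" "x \<in> e"
      by blast
    moreover have "(e, f) \<in> edge_rel G"
      using that by (auto simp: same_class_def)
    ultimately obtain y where "y \<in> f" "(x, y) \<in> vertex_rel G"
      using edge by blast
    then show False
      using class_closed[OF coloured_graphsD(1)[OF G] v(1) x(1)] v(3) by blast
  qed
  then have "{v \<in> vclasses G. v \<inter> e \<noteq> {}} = {v \<in> vclasses G. v \<inter> f \<noteq> {}}"
    if "u \<in> eclasses G" "e \<in> u" "f \<in> u" for u e f
    using that by blast
  moreover have "card {e \<in> u. x \<in> e} = card {e \<in> u. y \<in> e}"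
    if "v \<in> vclasses G" "x \<in> v" "y \<in> v" "u \<in> eclasses G" for v x y u
    using degree[OF that(4), of x y] that by (auto simp: same_class_def)
  ultimately show ?thesis
    unfolding regular_def by blast
qed

lemma cg_Inf_regular:
  assumes V: "finite V" and A: "A \<subseteq> regular_graphs V"
  shows "cg_Inf V A \<in> regular_graphs V"
proof -
  let ?I = "cg_Inf V A"
  have A': "A \<subseteq> coloured_graphs V"
    using A regular_graphsD(1) by blast
  have "regular ?I"
  proof (rule regularI[OF cg_Inf_coloured])
    fix e f x assume ef: "(e, f) \<in> edge_rel ?I" and x: "x \<in> e"
    then have "(e, f) \<in> (\<Union>G\<in>A. edge_rel G)\<^sup>*"
      by (simp add: edge_rel_cg_Inf)
    \<comment> \<open>Each link of the edge chain lies in one member of the family, whose regularity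
      moves the current endpoint to an equally coloured endpoint of the next edge. These moves form
      a vertex chain.\<close>
    then have "\<exists>y\<in>f. (x, y) \<in> (\<Union>G\<in>A. vertex_rel G)\<^sup>*"
    proof induction
      case (step f g)
      then obtain G y where "G \<in> A" "(f, g) \<in> edge_rel G" "y \<in> f"
        and y: "(x, y) \<in> (\<Union>G\<in>A. vertex_rel G)\<^sup>*"
        by blast
      then obtain z where "z \<in> g" "(y, z) \<in> vertex_rel G"
        using A regular_graphsD regular_edge_rel by (metis subsetD)
      then show ?case
        using y \<open>G \<in> A\<close> by (blast intro: rtrancl_into_rtrancl)
    qed (use x in blast)
    then obtain y where y: "y \<in> f" "(x, y) \<in> (\<Union>G\<in>A. vertex_rel G)\<^sup>*"
      by blast
    moreover have "x \<in> V" "y \<in> V"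
      using edge_rel_Field[OF ef] coloured_graphsD(3)[OF cg_Inf_coloured] x y(1) by blast+
    ultimately show "\<exists>y\<in>f. (x, y) \<in> vertex_rel ?I"
      by (auto simp: vertex_rel_cg_Inf)
  next
    fix u x y assume u: "u \<in> eclasses ?I" and "(x, y) \<in> vertex_rel ?I"
    then have "(x, y) \<in> (\<Union>G\<in>A. vertex_rel G)\<^sup>*"
      by (simp add: vertex_rel_cg_Inf)
    then show "card {e \<in> u. x \<in> e} = card {e \<in> u. y \<in> e}"
    proof induction
      case (step y z)
      then obtain G where G: "G \<in> A" "(y, z) \<in> vertex_rel G"
        by blast
      then have G': "G \<in> coloured_graphs V" "regular G"
        using A regular_graphsD by blast+
      have le: "cg_le V ?I G"
        by (rule cg_Inf_lower[OF A' G(1)])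
      have "u \<subseteq> edges ?I"
        using u by (auto simp: edges_def)
      \<comment> \<open>Since the infimum lies below \<open>G\<close>, its class \<open>u\<close> is
        closed under the edge colouring of \<open>G\<close>, and degrees in \<open>u\<close> agree
        on vertices that \<open>G\<close> colours alike.\<close>
      moreover have "f \<in> u" if "e \<in> u" "(e, f) \<in> edge_rel G" for e f
      proof -
        have "(e, f) \<in> edge_rel ?I"
          using cg_leD(3)[OF le cg_Inf_coloured G'(1) _ that(2)] that(1) \<open>u \<subseteq> edges ?I\<close> by blast
        then show ?thesis
          by (rule class_closed[OF coloured_graphsD(2)[OF cg_Inf_coloured] u that(1)])
      qed
      ultimately have "card {e \<in> u. y \<in> e} = card {e \<in> u. z \<in> e}"
        using cg_leD(1)[OF le cg_Inf_coloured G'(1)]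
        by (intro regular_degree_closed[OF V G' G(2)]) blast+
      with step show ?case
        by simp
    qed simp
  qed
  then show ?thesis
    by (simp add: regular_graphs_def cg_Inf_coloured)
qed


section \<open>Factor graphs and the coarsest regular refinement\<close>

lemma factor_colouring_partition:
  assumes G: "G \<in> coloured_graphs V"
  shows "partition_on (factor_nodes V G) (factor_colouring G)"
proof (rule partition_onI)
  note P = coloured_graphsD(1,2)[OF G]
  show "\<Union>(factor_colouring G) = factor_nodes V G"
    using P[THEN partition_onD1] by (simp add: factor_colouring_def factor_nodes_def image_Union)
  show "{} \<notin> factor_colouring G"
    using P[THEN partition_onD3] by (auto simp: factor_colouring_def)
  have "p = q" if pq: "p \<in> factor_colouring G" "q \<in> factor_colouring G" "z \<in> p" "z \<in> q" for p q z
  proof (cases z)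
    case (Inl x)
    then obtain v w where "p = Inl ` v" "q = Inl ` w" "v \<in> vclasses G" "w \<in> vclasses G" "x \<in> v" "x \<in> w"
      using pq by (auto simp: factor_colouring_def)
    then show ?thesis
      using partition_on_class_unique[OF P(1)] by metis
  next
    case (Inr e)
    then obtain v w where "p = Inr ` v" "q = Inr ` w" "v \<in> eclasses G" "w \<in> eclasses G" "e \<in> v" "e \<in> w"
      using pq by (auto simp: factor_colouring_def)
    then show ?thesis
      using partition_on_class_unique[OF P(2)] by metis
  qed
  then show "disjnt p q" if "p \<in> factor_colouring G" "q \<in> factor_colouring G" "p \<noteq> q" for p q
    using that by (meson disjnt_iff)
qed

lemma same_class_factor_colouring:
  "(Inl x, Inl y) \<in> same_class (factor_colouring G) \<longleftrightarrow> (x, y) \<in> vertex_rel G"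
  "(Inr e, Inr f) \<in> same_class (factor_colouring G) \<longleftrightarrow> (e, f) \<in> edge_rel G"
  "(Inl x, Inr f) \<notin> same_class (factor_colouring G)"
  "(Inr e, Inl y) \<notin> same_class (factor_colouring G)"
  by (auto simp: same_class_def factor_colouring_def)

text \<open>Turns the extremal property in \<open>coarsest_equitable\<close> into one for
  \<open>cg_le\<close>. The directions are opposite: a finer colouring is a larger graph, so
  coarsest means least.\<close>

lemma refines_factor_colouring_iff:
  assumes G: "G \<in> coloured_graphs V" and H: "H \<in> coloured_graphs V" and E: "edges G = edges H"
  shows "refines (factor_nodes V G) (factor_colouring H) (factor_colouring G) \<longleftrightarrow> cg_le V G H"
proof -
  have P: "partition_on (factor_nodes V G) (factor_colouring H)"
    using factor_colouring_partition[OF H] E by (simp add: factor_nodes_def)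
  have "refines (factor_nodes V G) (factor_colouring H) (factor_colouring G) \<longleftrightarrow>
    vertex_rel H \<subseteq> vertex_rel G \<and> edge_rel H \<subseteq> edge_rel G"
    unfolding refines_iff_same_class[OF P factor_colouring_partition[OF G]]
    by (simp add: subset_iff same_class_factor_colouring split_sum_all)
  also have "\<dots> \<longleftrightarrow> cg_le V G H"
    using edge_rel_Field[of _ _ H] unfolding cg_le_iff[OF G H] E by fast
  finally show ?thesis .
qed

lemma factor_colouring_inject:
  assumes "factor_colouring G = factor_colouring H"
    and G: "G \<in> coloured_graphs V" and H: "H \<in> coloured_graphs V"
  shows "G = H"
proof -
  \<comment> \<open>The guard against \<open>{}\<close> matters: the empty set is an image under
    both injections, and only nonempty images tell vertices from factor nodes.\<close>
  have eq: "vclasses X = {v. v \<noteq> {} \<and> Inl ` v \<in> factor_colouring X}"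
    "eclasses X = {u. u \<noteq> {} \<and> Inr ` u \<in> factor_colouring X}" if X: "X \<in> coloured_graphs V" for X
    using coloured_graphsD(1,2)[OF X, THEN partition_onD3]
    by (auto simp: factor_colouring_def inj_image_eq_iff)
  show ?thesis
    using eq[OF G] eq[OF H] assms(1) by (simp add: prod_eq_iff)
qed

lemma mem_image_image_Diff_iff:
  "p \<in> f ` (g ` Q - {{}}) \<longleftrightarrow> (\<exists>q\<in>Q. g q \<noteq> {} \<and> p = f (g q))"
  by blast

text \<open>A class of \<open>Q\<close> lies inside a class of the factor colouring, hence never
  mixes vertices with factor nodes, and pulling back along both injections loses nothing. A class of
  the other kind pulls back to \<open>{}\<close>, which is removed.\<close>

lemma factor_colouring_surj:
  assumes G: "G \<in> coloured_graphs V" and Q: "refines (factor_nodes V G) Q (factor_colouring G)"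
  obtains H where "H \<in> coloured_graphs V" "edges H = edges G" "factor_colouring H = Q"
proof -
  define H where "H = ((-`) Inl ` Q - {{}}, (-`) Inr ` Q - {{}})"
  have Q': "partition_on (factor_nodes V G) Q"
    and sub: "\<And>q. q \<in> Q \<Longrightarrow> \<exists>p\<in>factor_colouring G. q \<subseteq> p"
    using Q by (auto simp: refines_def)
  have "Inl -` factor_nodes V G = V" "Inr -` factor_nodes V G = edges G"
    by (auto simp: factor_nodes_def)
  then have V: "partition_on V (vclasses H)" and E: "partition_on (edges G) (eclasses H)"
    using partition_on_vimage[OF Q'] by (metis H_def fst_conv, metis H_def snd_conv)
  have edges: "edges H = edges G"
    using partition_onD1[OF E] by (simp add: edges_def)
  have cases: "q = Inl ` (Inl -` q) \<and> Inr -` q = {} \<or> q = Inr ` (Inr -` q) \<and> Inl -` q = {}"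
    if "q \<in> Q" for q
    using sub[OF that] unfolding factor_colouring_def by blast
  have ne: "q \<noteq> {}" if "q \<in> Q" for q
    using partition_onD3[OF Q'] that by blast
  have mem: "p \<in> factor_colouring H \<longleftrightarrow>
    (\<exists>q\<in>Q. Inl -` q \<noteq> {} \<and> p = Inl ` (Inl -` q)) \<or> (\<exists>q\<in>Q. Inr -` q \<noteq> {} \<and> p = Inr ` (Inr -` q))"
    for p
    by (simp only: factor_colouring_def H_def fst_conv snd_conv Un_iff mem_image_image_Diff_iff)
  have "factor_colouring H = Q"
  proof (rule Set.set_eqI, rule iffI)
    show "p \<in> Q" if "p \<in> factor_colouring H" for p
      using that cases unfolding mem by metis
    show "q \<in> factor_colouring H" if "q \<in> Q" for q
      using cases[OF that] ne[OF that] that unfolding mem by (metis image_empty)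
  qed
  moreover have "H \<in> coloured_graphs V"
    using V E coloured_graphsD(3,4)[OF G] by (intro coloured_graphsI) (simp_all add: edges)
  ultimately show thesis
    using that edges by blast
qed

lemma neighbours_vertex:
  "\<alpha> \<in> V \<Longrightarrow> neighbours (factor_edges V G) (Inl \<alpha>) = Inr ` {e \<in> edges G. \<alpha> \<in> e}"
  by (auto simp: neighbours_def factor_edges_def doubleton_eq_iff)

lemma neighbours_factor:
  assumes "G \<in> coloured_graphs V" "e \<in> edges G"
  shows "neighbours (factor_edges V G) (Inr e) = Inl ` e"
  using assms(2) coloured_graphsD(3)[OF assms(1)]
  by (auto simp: neighbours_def factor_edges_def doubleton_eq_iff)

text \<open>The factor graph is bipartite: counts between nodes of the same kind vanish, and the
  remaining two kinds are degrees in edge classes and numbers of endpoints in vertex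
  classes.\<close>

lemma equitable_factor_colouring_iff:
  assumes G: "G \<in> coloured_graphs V"
  shows "equitable (factor_edges V G) (factor_colouring G) \<longleftrightarrow>
    (\<forall>v\<in>vclasses G. \<forall>\<alpha>\<in>v. \<forall>\<beta>\<in>v. \<forall>u\<in>eclasses G.
       card {e \<in> u. \<alpha> \<in> e} = card {e \<in> u. \<beta> \<in> e}) \<and>
    (\<forall>u\<in>eclasses G. \<forall>e\<in>u. \<forall>f\<in>u. \<forall>v\<in>vclasses G. card (e \<inter> v) = card (f \<inter> v))"
proof -
  let ?N = "neighbours (factor_edges V G)"
  have V: "\<alpha> \<in> V" if "v \<in> vclasses G" "\<alpha> \<in> v" for v \<alpha>
    using partition_onD1[OF coloured_graphsD(1)[OF G]] that by blast
  have vertex: "card (?N (Inl \<alpha>) \<inter> Inl ` w) = 0" if "v \<in> vclasses G" "\<alpha> \<in> v" for v w \<alpha>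
  proof -
    have "?N (Inl \<alpha>) \<inter> Inl ` w = {}"
      unfolding neighbours_vertex[OF V[OF that]] by blast
    then show ?thesis
      by simp
  qed
  have degree: "card (?N (Inl \<alpha>) \<inter> Inr ` u) = card {e \<in> u. \<alpha> \<in> e}"
    if "v \<in> vclasses G" "\<alpha> \<in> v" "u \<in> eclasses G" for v u \<alpha>
  proof -
    have "u \<subseteq> edges G"
      using that by (auto simp: edges_def)
    then have "?N (Inl \<alpha>) \<inter> Inr ` u = Inr ` {e \<in> u. \<alpha> \<in> e}"
      unfolding neighbours_vertex[OF V[OF that(1,2)]] by blast
    then show ?thesis
      by (simp add: card_image)
  qed
  have factor: "card (?N (Inr e) \<inter> Inr ` w) = 0" "card (?N (Inr e) \<inter> Inl ` v) = card (e \<inter> v)"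
    if "u \<in> eclasses G" "e \<in> u" for u e w v
  proof -
    have e: "e \<in> edges G"
      using that by (auto simp: edges_def)
    have "?N (Inr e) \<inter> Inr ` w = {}"
      unfolding neighbours_factor[OF G e] by blast
    then show "card (?N (Inr e) \<inter> Inr ` w) = 0"
      by simp
    have "?N (Inr e) \<inter> Inl ` v = Inl ` (e \<inter> v)"
      unfolding neighbours_factor[OF G e] by blast
    then show "card (?N (Inr e) \<inter> Inl ` v) = card (e \<inter> v)"
      by (simp add: card_image)
  qed
  show ?thesis
  proof (intro iffI conjI ballI)
    assume eq: "equitable (factor_edges V G) (factor_colouring G)"
    have eq': "card (?N x \<inter> w) = card (?N y \<inter> w)"
      if "v \<in> factor_colouring G" "w \<in> factor_colouring G" "x \<in> v" "y \<in> v" for v w x y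
      using eq that unfolding equitable_def by blast
    show "card {e \<in> u. \<alpha> \<in> e} = card {e \<in> u. \<beta> \<in> e}"
      if "v \<in> vclasses G" "\<alpha> \<in> v" "\<beta> \<in> v" "u \<in> eclasses G" for v \<alpha> \<beta> u
      using eq'[of "Inl ` v" "Inr ` u" "Inl \<alpha>" "Inl \<beta>"] that degree[OF that(1) _ that(4)]
      by (simp add: factor_colouring_def)
    show "card (e \<inter> v) = card (f \<inter> v)"
      if "u \<in> eclasses G" "e \<in> u" "f \<in> u" "v \<in> vclasses G" for u e f v
      using eq'[of "Inr ` u" "Inl ` v" "Inr e" "Inr f"] that factor(2)[OF that(1)]
      by (simp add: factor_colouring_def)
  next
    assume *: "(\<forall>v\<in>vclasses G. \<forall>\<alpha>\<in>v. \<forall>\<beta>\<in>v. \<forall>u\<in>eclasses G.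
        card {e \<in> u. \<alpha> \<in> e} = card {e \<in> u. \<beta> \<in> e}) \<and>
      (\<forall>u\<in>eclasses G. \<forall>e\<in>u. \<forall>f\<in>u. \<forall>v\<in>vclasses G. card (e \<inter> v) = card (f \<inter> v))"
    have split: "(\<forall>p\<in>factor_colouring G. P p) \<longleftrightarrow>
      (\<forall>v\<in>vclasses G. P (Inl ` v)) \<and> (\<forall>u\<in>eclasses G. P (Inr ` u))" for P
      unfolding factor_colouring_def by blast
    show "equitable (factor_edges V G) (factor_colouring G)"
      unfolding equitable_def split ball_simps(9)
    proof (intro conjI ballI)
      show "card (?N (Inl \<alpha>) \<inter> Inl ` w) = card (?N (Inl \<beta>) \<inter> Inl ` w)"
        if "v \<in> vclasses G" "\<alpha> \<in> v" "\<beta> \<in> v" for v w \<alpha> \<beta>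
        using vertex[OF that(1)] that by simp
      show "card (?N (Inl \<alpha>) \<inter> Inr ` u) = card (?N (Inl \<beta>) \<inter> Inr ` u)"
        if "v \<in> vclasses G" "u \<in> eclasses G" "\<alpha> \<in> v" "\<beta> \<in> v" for v u \<alpha> \<beta>
        unfolding degree[OF that(1,3,2)] degree[OF that(1,4,2)]
        by (rule *[THEN conjunct1, rule_format, OF that(1,3,4,2)])
      show "card (?N (Inr e) \<inter> Inl ` v) = card (?N (Inr f) \<inter> Inl ` v)"
        if "u \<in> eclasses G" "v \<in> vclasses G" "e \<in> u" "f \<in> u" for u v e f
        unfolding factor(2)[OF that(1,3)] factor(2)[OF that(1,4)]
        by (rule *[THEN conjunct2, rule_format, OF that(1,3,4,2)])
      show "card (?N (Inr e) \<inter> Inr ` w) = card (?N (Inr f) \<inter> Inr ` w)"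
        if "u \<in> eclasses G" "e \<in> u" "f \<in> u" for u w e f
        using factor(1)[OF that(1)] that by simp
    qed
  qed
qed

text \<open>
  As an edge has only two endpoints, the set of vertex colour classes that it meets determines how
  many endpoints it has in each class.
\<close>

lemma regular_iff_equitable:
  assumes G: "G \<in> coloured_graphs V"
  shows "regular G \<longleftrightarrow> equitable (factor_edges V G) (factor_colouring G)"
proof -
  have "(\<forall>u\<in>eclasses G. \<forall>e\<in>u. \<forall>f\<in>u.
      {v \<in> vclasses G. v \<inter> e \<noteq> {}} = {v \<in> vclasses G. v \<inter> f \<noteq> {}}) \<longleftrightarrow>
    (\<forall>u\<in>eclasses G. \<forall>e\<in>u. \<forall>f\<in>u. \<forall>v\<in>vclasses G. card (e \<inter> v) = card (f \<inter> v))"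
  proof (intro ball_cong refl)
    fix u e f assume "u \<in> eclasses G" "e \<in> u" "f \<in> u"
    then have ef: "e \<in> edges G" "f \<in> edges G"
      by (auto simp: edges_def)
    have fin: "finite g" "card g = 2" if "g \<in> edges G" for g
      using coloured_graphsD(4)[OF G that] by (auto intro: card_ge_0_finite)
    \<comment> \<open>The counts lie in {0, 1, 2}, so it is enough to recognise 0 and 2 from the set
      of classes met: 0 if \<open>v\<close> is missed, 2 if \<open>v\<close> is the only class
      met.\<close>
    have two: "card (g \<inter> v) = 2 \<longleftrightarrow> (\<forall>w\<in>vclasses G. w \<inter> g \<noteq> {} \<longrightarrow> w = v)"
      if g: "g \<in> edges G" and v: "v \<in> vclasses G" for g v
    proof -
      have "card (g \<inter> v) = 2 \<longleftrightarrow> g \<inter> v = g"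
        using fin[OF g] card_subset_eq[of g "g \<inter> v"] by auto
      also have "\<dots> \<longleftrightarrow> (\<forall>w\<in>vclasses G. w \<inter> g \<noteq> {} \<longrightarrow> w = v)"
      proof
        assume "g \<inter> v = g"
        then show "\<forall>w\<in>vclasses G. w \<inter> g \<noteq> {} \<longrightarrow> w = v"
          using partition_on_class_unique[OF coloured_graphsD(1)[OF G] _ v] by blast
      next
        assume "\<forall>w\<in>vclasses G. w \<inter> g \<noteq> {} \<longrightarrow> w = v"
        moreover have "g \<subseteq> \<Union>(vclasses G)"
          using coloured_graphsD(3)[OF G g] partition_onD1[OF coloured_graphsD(1)[OF G]] by simp
        ultimately show "g \<inter> v = g"
          by blast
      qed
      finally show ?thesis .
    qed
    have zero: "card (g \<inter> v) = 0 \<longleftrightarrow> v \<inter> g = {}" if "g \<in> edges G" for g v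
      using fin[OF that] by (auto simp: Int_commute)
    have le: "card (g \<inter> v) \<le> 2" if "g \<in> edges G" for g v
      using fin[OF that] card_mono[of g "g \<inter> v"] by simp
    show "{v \<in> vclasses G. v \<inter> e \<noteq> {}} = {v \<in> vclasses G. v \<inter> f \<noteq> {}} \<longleftrightarrow>
      (\<forall>v\<in>vclasses G. card (e \<inter> v) = card (f \<inter> v))" (is "?L \<longleftrightarrow> ?R")
    proof
      assume L: ?L
      show ?R
      proof
        fix v assume v: "v \<in> vclasses G"
        have "card (e \<inter> v) = 0 \<longleftrightarrow> card (f \<inter> v) = 0"
          unfolding zero[OF ef(1)] zero[OF ef(2)] using L v by blast
        moreover have "card (e \<inter> v) = 2 \<longleftrightarrow> card (f \<inter> v) = 2"
          unfolding two[OF ef(1) v] two[OF ef(2) v] using L by blast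
        ultimately show "card (e \<inter> v) = card (f \<inter> v)"
          using le[OF ef(1), of v] le[OF ef(2), of v] by linarith
      qed
    next
      assume R: ?R
      then have "v \<inter> e = {} \<longleftrightarrow> v \<inter> f = {}" if "v \<in> vclasses G" for v
        using zero[OF ef(1), of v] zero[OF ef(2), of v] that by simp
      then show ?L
        by blast
    qed
  qed
  then show ?thesis
    unfolding regular_def equitable_factor_colouring_iff[OF G] by (simp only: conj_commute)
qed

text \<open>Ensures that some regular graph above \<open>G\<close> has the same edges. Without such
  a member the infimum in \<open>s_R_least\<close> would be taken over the empty family and be the
  complete graph.\<close>

lemma regular_discrete_refinement:
  assumes G: "G \<in> coloured_graphs V"
  defines "D \<equiv> ((\<lambda>x. {x}) ` V, (\<lambda>e. {e}) ` edges G)"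
  shows "D \<in> regular_graphs V" "edges D = edges G" "cg_le V G D"
proof -
  show E: "edges D = edges G"
    by (auto simp: D_def edges_def)
  have "partition_on (edges G) ((\<lambda>e. {e}) ` edges G)" "partition_on V ((\<lambda>x. {x}) ` V)"
    by (rule partition_on_singletons)+
  then have D: "D \<in> coloured_graphs V"
    using coloured_graphsD(3,4)[OF G]
    by (intro coloured_graphsI) (simp_all only: E, simp_all add: D_def)
  have v: "vertex_rel D = Id_on V" and e: "edge_rel D = Id_on (edges G)"
    by (auto simp: D_def same_class_def)
  have "regular D"
    using coloured_graphsD(3)[OF G] by (intro regularI[OF D]) (auto simp: v e)
  then show "D \<in> regular_graphs V"
    using D by (simp add: regular_graphs_def)
  show "cg_le V G D"
    unfolding cg_le_iff[OF G D] v e E using vertex_rel_refl[OF G] edge_rel_refl[of _ G] by auto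
qed

text \<open>Each class of \<open>G\<close> is a union of classes of \<open>X\<close>, so the classes
  of \<open>X\<close> inside \<open>edges G\<close> cover all of \<open>edges G\<close>. Both
  regularity conditions concern one edge class at a time and the vertex classes are kept, so
  dropping whole edge classes preserves regularity.\<close>

lemma regular_restriction:
  assumes G: "G \<in> coloured_graphs V" and X: "X \<in> regular_graphs V" and le: "cg_le V G X"
  defines "Y \<equiv> (vclasses X, {u \<in> eclasses X. u \<subseteq> edges G})"
  shows "Y \<in> regular_graphs V" "edges Y = edges G" "cg_le V G Y" "cg_le V Y X"
proof -
  have X': "X \<in> coloured_graphs V"
    using X by (rule regular_graphsD)
  have "e \<in> edges Y" if e: "e \<in> edges G" for e
  proof -
    obtain u where u: "u \<in> eclasses G" "e \<in> u"
      using e by (auto simp: edges_def)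
    then have "\<exists>U\<subseteq>eclasses X. u = \<Union>U"
      using le by (simp add: cg_le_def)
    then obtain U where U: "U \<subseteq> eclasses X" "u = \<Union>U"
      by (elim exE conjE)
    then obtain w where w: "w \<in> U" "e \<in> w"
      using u(2) by blast
    moreover have "w \<subseteq> edges G"
      using w(1) u(1) unfolding U(2) edges_def by blast
    ultimately show ?thesis
      using U(1) by (auto simp: Y_def edges_def)
  qed
  then show E: "edges Y = edges G"
    by (auto simp: Y_def edges_def)
  have sub: "eclasses Y \<subseteq> eclasses X"
    by (auto simp: Y_def)
  then have "partition_on (edges Y) (eclasses Y)"
    using coloured_graphsD(2)[OF X'] pairwise_subset[OF _ sub]
    by (auto simp: partition_on_def edges_def)
  moreover have vY: "vclasses Y = vclasses X"
    by (simp add: Y_def)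
  ultimately have Y: "Y \<in> coloured_graphs V"
    using coloured_graphsD(1)[OF X'] coloured_graphsD(3,4)[OF G]
    by (intro coloured_graphsI) (simp_all add: E)
  have "regular Y"
  proof -
    note reg = regular_graphsD(2)[OF X, unfolded regular_def]
    show ?thesis
      unfolding regular_def vY
    proof (intro conjI ballI)
      show "{v \<in> vclasses X. v \<inter> e \<noteq> {}} = {v \<in> vclasses X. v \<inter> f \<noteq> {}}"
        if "u \<in> eclasses Y" "e \<in> u" "f \<in> u" for u e f
        by (rule reg[THEN conjunct1, rule_format, OF subsetD[OF sub that(1)] that(2,3)])
      show "card {e \<in> u. \<alpha> \<in> e} = card {e \<in> u. \<beta> \<in> e}"
        if "v \<in> vclasses X" "\<alpha> \<in> v" "\<beta> \<in> v" "u \<in> eclasses Y" for v \<alpha> \<beta> u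
        by (rule reg[THEN conjunct2, rule_format, OF that(1,2,3) subsetD[OF sub that(4)]])
    qed
  qed
  then show "Y \<in> regular_graphs V"
    using Y by (simp add: regular_graphs_def)
  have "\<exists>U\<subseteq>eclasses Y. u = \<Union>U" if u: "u \<in> eclasses G" for u
  proof -
    have "\<exists>U\<subseteq>eclasses X. u = \<Union>U"
      using le u by (simp add: cg_le_def)
    then obtain U where U: "U \<subseteq> eclasses X" "u = \<Union>U"
      by (elim exE conjE)
    have "u \<subseteq> edges G"
      using u by (auto simp: edges_def)
    then have "U \<subseteq> eclasses Y"
      using U by (auto simp: Y_def)
    then show ?thesis
      using U(2) by (intro exI conjI)
  qed
  then show "cg_le V G Y"
    using le E by (simp add: cg_le_def Y_def)
  have "edges Y \<subseteq> edges X"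
    using sub by (auto simp: edges_def)
  moreover have "\<exists>U\<subseteq>eclasses X. u = \<Union>U" if "u \<in> eclasses Y" for u
    using that sub by (intro exI[of _ "{u}"]) auto
  ultimately show "cg_le V Y X"
    using refines_refl[OF coloured_graphsD(1)[OF X']] by (simp add: cg_le_def Y_def)
qed

text \<open>The infimum \<open>K\<close> of the regular graphs above \<open>G\<close> with the edges
  of \<open>G\<close> is itself one of them. Its factor colouring therefore meets the description in
  \<open>coarsest_equitable\<close>, and injectivity of the factor graph construction gives
  \<open>s_R V G = K\<close>.\<close>

lemma s_R_least:
  assumes V: "finite V" and G: "G \<in> coloured_graphs V"
  shows "s_R V G \<in> regular_graphs V" "cg_le V G (s_R V G)"
    "\<And>X. \<lbrakk>X \<in> regular_graphs V; cg_le V G X\<rbrakk> \<Longrightarrow> cg_le V (s_R V G) X"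
proof -
  define A where "A = {X \<in> regular_graphs V. edges X = edges G \<and> cg_le V G X}"
  define K where "K = cg_Inf V A"
  have A: "A \<subseteq> regular_graphs V"
    by (auto simp: A_def)
  then have A': "A \<subseteq> coloured_graphs V"
    using regular_graphsD(1) by blast
  have K: "K \<in> regular_graphs V"
    unfolding K_def by (rule cg_Inf_regular[OF V A])
  then have K': "K \<in> coloured_graphs V"
    by (rule regular_graphsD)
  have GK: "cg_le V G K"
    unfolding K_def by (rule cg_Inf_greatest[OF A' G]) (simp add: A_def)
  have lower: "cg_le V K X" if "X \<in> A" for X
    unfolding K_def by (rule cg_Inf_lower[OF A' that])
  obtain D where "D \<in> A"
    using regular_discrete_refinement[OF G] unfolding A_def by blast
  then have "edges K \<subseteq> edges G"
    using cg_leD(1)[OF lower K'] A' unfolding A_def by blast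
  then have E: "edges K = edges G"
    using cg_leD(1)[OF GK G K'] by blast
  have nodes: "factor_nodes V X = factor_nodes V Y" "factor_edges V X = factor_edges V Y"
    if "edges X = edges Y" for X Y
    using that by (simp_all add: factor_nodes_def factor_edges_def)
  let ?coarsest = "\<lambda>R. refines (factor_nodes V G) R (factor_colouring G) \<and>
    equitable (factor_edges V G) R \<and>
    (\<forall>Q. refines (factor_nodes V G) Q (factor_colouring G) \<and> equitable (factor_edges V G) Q \<longrightarrow>
      refines (factor_nodes V G) Q R)"
  have "?coarsest (factor_colouring K)"
  proof (intro conjI allI impI)
    show "refines (factor_nodes V G) (factor_colouring K) (factor_colouring G)"
      using refines_factor_colouring_iff[OF G K'] E GK by simp
    show "equitable (factor_edges V G) (factor_colouring K)"
      using regular_iff_equitable[OF K'] regular_graphsD(2)[OF K] nodes(2)[OF E] by simp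
    fix Q
    assume Q: "refines (factor_nodes V G) Q (factor_colouring G) \<and> equitable (factor_edges V G) Q"
    then obtain X where X: "X \<in> coloured_graphs V" "edges X = edges G" "factor_colouring X = Q"
      using factor_colouring_surj[OF G] by blast
    have "regular X"
      using regular_iff_equitable[OF X(1)] X nodes(2)[OF X(2)] Q by simp
    moreover have "cg_le V G X"
      using refines_factor_colouring_iff[OF G X(1)] X Q by simp
    ultimately have "X \<in> A"
      using X by (simp add: A_def regular_graphs_def)
    then show "refines (factor_nodes V G) Q (factor_colouring K)"
      using refines_factor_colouring_iff[OF K' X(1)] lower X E nodes(1)[OF E] by simp
  qed
  then have "coarsest_equitable (factor_nodes V G) (factor_edges V G) (factor_colouring G) =
      factor_colouring K"
    unfolding coarsest_equitable_def
  proof (rule the_equality)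
    fix R assume R: "?coarsest R"
    with \<open>?coarsest (factor_colouring K)\<close> show "R = factor_colouring K"
      by (meson refines_asym)
  qed
  then have "s_R V G = inv_into (coloured_graphs V) (coloured_factor_graph V)
      (coloured_factor_graph V K)"
    using nodes(2)[OF E] by (simp add: s_R_def coloured_factor_graph_def)
  moreover have "inj_on (coloured_factor_graph V) (coloured_graphs V)"
    by (rule inj_onI) (metis coloured_factor_graph_def factor_colouring_inject fst_conv)
  ultimately have eq: "s_R V G = K"
    using K' by simp
  show "s_R V G \<in> regular_graphs V" "cg_le V G (s_R V G)"
    using K GK by (simp_all add: eq)
  \<comment> \<open>A competitor \<open>X\<close> may have more edges; its restriction
    \<open>Y\<close> to the edges of \<open>G\<close> belongs to \<open>A\<close> and lies between
    \<open>K\<close> and \<open>X\<close>.\<close>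
  show "cg_le V (s_R V G) X" if X: "X \<in> regular_graphs V" "cg_le V G X" for X
  proof -
    obtain Y where Y: "Y \<in> A" "cg_le V Y X"
      using regular_restriction[OF G X] unfolding A_def by blast
    then show ?thesis
      using cg_le_trans[OF K' _ regular_graphsD(1)[OF X(1)] lower] A' unfolding eq by blast
  qed
qed


section \<open>Models and their order\<close>

text \<open>By the inequality between product and squares, the entry at a pair costs at most
  \<open>m / 2\<close> times each of the two squares involved. Over all ordered pairs every square
  is charged \<open>m * card V\<close>, which the diagonal exceeds.\<close>

lemma sym_pos_def_dominant:
  fixes K :: "'a \<times> 'a \<Rightarrow> real"
  assumes V: "finite V" and ext: "K \<in> extensional (V \<times> V)"
    and sym: "\<And>\<alpha> \<beta>. \<lbrakk>\<alpha> \<in> V; \<beta> \<in> V\<rbrakk> \<Longrightarrow> K (\<alpha>, \<beta>) = K (\<beta>, \<alpha>)"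
    and off: "\<And>\<alpha> \<beta>. \<lbrakk>\<alpha> \<in> V; \<beta> \<in> V; \<alpha> \<noteq> \<beta>\<rbrakk> \<Longrightarrow> \<bar>K (\<alpha>, \<beta>)\<bar> \<le> m"
    and diag: "\<And>\<alpha>. \<alpha> \<in> V \<Longrightarrow> K (\<alpha>, \<alpha>) > m * card V" and m: "m \<ge> 0"
  shows "K \<in> sym_pos_def V"
proof -
  have "(\<Sum>\<alpha>\<in>V. \<Sum>\<beta>\<in>V. x \<alpha> * K (\<alpha>, \<beta>) * x \<beta>) > 0" if ex: "\<exists>\<alpha>\<in>V. x \<alpha> \<noteq> 0" for x
  proof -
    obtain \<gamma> where \<gamma>: "\<gamma> \<in> V" "x \<gamma> \<noteq> 0"
      using ex by blast
    \<comment> \<open>Diagonal pairs are charged as well, although they cost nothing: the charge is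
      then the same for all pairs and sums to \<open>m * card V\<close> per square.\<close>
    have bound: "(if \<alpha> = \<beta> then K (\<alpha>, \<alpha>) * (x \<alpha>)\<^sup>2 else 0) - m / 2 * (x \<alpha>)\<^sup>2 - m / 2 * (x \<beta>)\<^sup>2
        \<le> x \<alpha> * K (\<alpha>, \<beta>) * x \<beta>" if "\<alpha> \<in> V" "\<beta> \<in> V" for \<alpha> \<beta>
    proof (cases "\<alpha> = \<beta>")
      case True
      then show ?thesis
        using m by (simp add: power2_eq_square algebra_simps)
    next
      case False
      have "2 * \<bar>x \<alpha>\<bar> * \<bar>x \<beta>\<bar> \<le> (x \<alpha>)\<^sup>2 + (x \<beta>)\<^sup>2"
        using sum_squares_bound[of "\<bar>x \<alpha>\<bar>" "\<bar>x \<beta>\<bar>"] by simp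
      then have "m * (2 * \<bar>x \<alpha>\<bar> * \<bar>x \<beta>\<bar>) \<le> m * ((x \<alpha>)\<^sup>2 + (x \<beta>)\<^sup>2)"
        using m by (rule mult_left_mono)
      moreover have "\<bar>x \<alpha> * K (\<alpha>, \<beta>) * x \<beta>\<bar> \<le> m * (\<bar>x \<alpha>\<bar> * \<bar>x \<beta>\<bar>)"
        using mult_right_mono[OF off[OF that False], of "\<bar>x \<alpha>\<bar> * \<bar>x \<beta>\<bar>"]
        by (simp add: abs_mult mult_ac)
      ultimately show ?thesis
        using False by (simp add: algebra_simps abs_le_iff)
    qed
    let ?S = "\<Sum>\<alpha>\<in>V. (x \<alpha>)\<^sup>2"
    have "0 < (\<Sum>\<alpha>\<in>V. (K (\<alpha>, \<alpha>) - m * card V) * (x \<alpha>)\<^sup>2)"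
    proof (rule sum_pos2[OF V \<gamma>(1)])
      show "0 < (K (\<gamma>, \<gamma>) - m * card V) * (x \<gamma>)\<^sup>2"
        using diag[OF \<gamma>(1)] \<gamma>(2) by simp
      show "0 \<le> (K (\<alpha>, \<alpha>) - m * card V) * (x \<alpha>)\<^sup>2" if "\<alpha> \<in> V" for \<alpha>
        using diag[OF that] by (intro mult_nonneg_nonneg) simp_all
    qed
    also have "\<dots> = (\<Sum>\<alpha>\<in>V. K (\<alpha>, \<alpha>) * (x \<alpha>)\<^sup>2) - m * card V * ?S"
      by (simp add: left_diff_distrib sum_subtractf sum_distrib_left)
    \<comment> \<open>The total charge is split into halves: one is attached to the row square,
      counted \<open>card V\<close> times, the other is the sum over a whole row of the column
      squares.\<close>
    also have "\<dots> = (\<Sum>\<alpha>\<in>V. K (\<alpha>, \<alpha>) * (x \<alpha>)\<^sup>2 - card V * (m / 2 * (x \<alpha>)\<^sup>2) - m / 2 * ?S)"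
    proof -
      have "(\<Sum>\<alpha>\<in>V. card V * (m / 2 * (x \<alpha>)\<^sup>2)) = card V * (m / 2 * ?S)"
        by (simp add: sum_distrib_left)
      then show ?thesis
        by (simp only: sum_subtractf sum_constant) (simp add: field_simps)
    qed
    also have "\<dots> = (\<Sum>\<alpha>\<in>V. \<Sum>\<beta>\<in>V.
        (if \<alpha> = \<beta> then K (\<alpha>, \<alpha>) * (x \<alpha>)\<^sup>2 else 0) - m / 2 * (x \<alpha>)\<^sup>2 - m / 2 * (x \<beta>)\<^sup>2)"
    proof (intro sum.cong refl)
      fix \<alpha> assume "\<alpha> \<in> V"
      then have "(\<Sum>\<beta>\<in>V. if \<alpha> = \<beta> then K (\<alpha>, \<alpha>) * (x \<alpha>)\<^sup>2 else 0) = K (\<alpha>, \<alpha>) * (x \<alpha>)\<^sup>2"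
        using V by simp
      moreover have "(\<Sum>\<beta>\<in>V. m / 2 * (x \<beta>)\<^sup>2) = m / 2 * ?S"
        by (simp add: sum_distrib_left)
      ultimately show "K (\<alpha>, \<alpha>) * (x \<alpha>)\<^sup>2 - card V * (m / 2 * (x \<alpha>)\<^sup>2) - m / 2 * ?S =
        (\<Sum>\<beta>\<in>V. (if \<alpha> = \<beta> then K (\<alpha>, \<alpha>) * (x \<alpha>)\<^sup>2 else 0) - m / 2 * (x \<alpha>)\<^sup>2 - m / 2 * (x \<beta>)\<^sup>2)"
        by (simp only: sum_subtractf sum_constant)
    qed
    also have "\<dots> \<le> (\<Sum>\<alpha>\<in>V. \<Sum>\<beta>\<in>V. x \<alpha> * K (\<alpha>, \<beta>) * x \<beta>)"
      by (intro sum_mono bound)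
    finally show ?thesis .
  qed
  then show ?thesis
    using ext sym by (simp add: sym_pos_def_def)
qed

lemma rcon_model_iff:
  "K \<in> rcon_model V G \<longleftrightarrow> K \<in> sym_pos_def V \<and>
    (\<forall>\<alpha>\<in>V. \<forall>\<beta>\<in>V. \<alpha> \<noteq> \<beta> \<and> {\<alpha>, \<beta>} \<notin> edges G \<longrightarrow> K (\<alpha>, \<beta>) = 0) \<and>
    (\<forall>\<alpha> \<beta>. (\<alpha>, \<beta>) \<in> vertex_rel G \<longrightarrow> K (\<alpha>, \<alpha>) = K (\<beta>, \<beta>)) \<and>
    (\<forall>\<alpha> \<beta> \<gamma> \<delta>. ({\<alpha>, \<beta>}, {\<gamma>, \<delta>}) \<in> edge_rel G \<longrightarrow> K (\<alpha>, \<beta>) = K (\<gamma>, \<delta>))"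
proof -
  have "(\<forall>v\<in>vclasses G. \<forall>\<alpha>\<in>v. \<forall>\<beta>\<in>v. P \<alpha> \<beta>) \<longleftrightarrow>
    (\<forall>\<alpha> \<beta>. (\<alpha>, \<beta>) \<in> vertex_rel G \<longrightarrow> P \<alpha> \<beta>)" for P
    unfolding same_class_def by blast
  moreover have "(\<forall>u\<in>eclasses G. \<forall>\<alpha> \<beta> \<gamma> \<delta>. {\<alpha>, \<beta>} \<in> u \<and> {\<gamma>, \<delta>} \<in> u \<longrightarrow> Q \<alpha> \<beta> \<gamma> \<delta>) \<longleftrightarrow>
    (\<forall>\<alpha> \<beta> \<gamma> \<delta>. ({\<alpha>, \<beta>}, {\<gamma>, \<delta>}) \<in> edge_rel G \<longrightarrow> Q \<alpha> \<beta> \<gamma> \<delta>)" for Q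
    unfolding same_class_def by blast
  ultimately show ?thesis
    by (simp only: rcon_model_def mem_Collect_eq)
qed

text \<open>Injective numberings of the vertex and edge classes give different entries to different
  classes, so no equation holds among diagonal entries or among edge entries beyond those the
  colouring imposes.\<close>

lemma generic_matrix:
  assumes V: "finite V" and G: "G \<in> coloured_graphs V"
  obtains K where "K \<in> rcon_model V G"
    "\<And>\<alpha> \<beta>. {\<alpha>, \<beta>} \<in> edges G \<Longrightarrow> K (\<alpha>, \<beta>) \<noteq> 0"
    "\<And>\<alpha> \<beta>. \<lbrakk>\<alpha> \<in> V; \<beta> \<in> V; K (\<alpha>, \<alpha>) = K (\<beta>, \<beta>)\<rbrakk> \<Longrightarrow> (\<alpha>, \<beta>) \<in> vertex_rel G"
    "\<And>\<alpha> \<beta> \<gamma> \<delta>. \<lbrakk>{\<alpha>, \<beta>} \<in> edges G; {\<gamma>, \<delta>} \<in> edges G; K (\<alpha>, \<beta>) = K (\<gamma>, \<delta>)\<rbrakk> \<Longrightarrow>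
      ({\<alpha>, \<beta>}, {\<gamma>, \<delta>}) \<in> edge_rel G"
proof -
  let ?v = "\<lambda>\<alpha>. vertex_rel G `` {\<alpha>}" and ?e = "\<lambda>e. edge_rel G `` {e}"
  have "finite (?v ` V)" "finite (?e ` edges G)"
    using V finite_edges[OF V G] by simp_all
  then obtain f g :: "_ \<Rightarrow> nat" and n m where f: "inj_on f (?v ` V)"
    and g: "g ` ?e ` edges G = {i. i < m}" "inj_on g (?e ` edges G)"
    using finite_imp_inj_to_nat_seg[of "?v ` V"] finite_imp_inj_to_nat_seg[of "?e ` edges G"] by metis
  \<comment> \<open>The numbers \<open>g\<close> are below \<open>m\<close>, the number of edge
    classes, so edge entries lie between 1 and \<open>m\<close>; adding 1 keeps them nonzero. The
    offset \<open>m * card V + 1\<close> puts the diagonal above the bound of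
    \<open>sym_pos_def_dominant\<close>.\<close>
  define K where "K = restrict (\<lambda>(\<alpha>, \<beta>). if \<alpha> = \<beta> then real (m * card V + 1 + f (?v \<alpha>))
    else if {\<alpha>, \<beta>} \<in> edges G then real (1 + g (?e {\<alpha>, \<beta>})) else 0) (V \<times> V)"
  have edge: "\<alpha> \<in> V \<and> \<beta> \<in> V \<and> \<alpha> \<noteq> \<beta>" if "{\<alpha>, \<beta>} \<in> edges G" for \<alpha> \<beta>
    using coloured_graphsD(3,4)[OF G that] by auto
  have K_edge: "K (\<alpha>, \<beta>) = real (1 + g (?e {\<alpha>, \<beta>}))" if "{\<alpha>, \<beta>} \<in> edges G" for \<alpha> \<beta>
    using edge[OF that] that by (simp add: K_def)
  have K_diag: "K (\<alpha>, \<alpha>) = real (m * card V + 1 + f (?v \<alpha>))" if "\<alpha> \<in> V" for \<alpha>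
    using that by (simp add: K_def)
  have v: "f (?v \<alpha>) = f (?v \<beta>) \<longleftrightarrow> (\<alpha>, \<beta>) \<in> vertex_rel G" if "\<alpha> \<in> V" "\<beta> \<in> V" for \<alpha> \<beta>
    using inj_on_eq_iff[OF f, of "?v \<alpha>" "?v \<beta>"] eq_equiv_class_iff[OF coloured_graphsD(5)[OF G]] that
    by simp
  have e: "g (?e a) = g (?e b) \<longleftrightarrow> (a, b) \<in> edge_rel G" if "a \<in> edges G" "b \<in> edges G" for a b
    using inj_on_eq_iff[OF g(2), of "?e a" "?e b"] eq_equiv_class_iff[OF coloured_graphsD(6)[OF G]] that
    by simp
  have "K \<in> sym_pos_def V"
  proof (rule sym_pos_def_dominant[OF V, of _ "real m"])
    show "K \<in> extensional (V \<times> V)"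
      by (simp add: K_def)
    show "K (\<alpha>, \<beta>) = K (\<beta>, \<alpha>)" if "\<alpha> \<in> V" "\<beta> \<in> V" for \<alpha> \<beta>
      using that by (simp add: K_def insert_commute)
    show "\<bar>K (\<alpha>, \<beta>)\<bar> \<le> real m" if "\<alpha> \<in> V" "\<beta> \<in> V" "\<alpha> \<noteq> \<beta>" for \<alpha> \<beta>
    proof (cases "{\<alpha>, \<beta>} \<in> edges G")
      case True
      then have "g (?e {\<alpha>, \<beta>}) < m"
        using g(1) by blast
      then show ?thesis
        using K_edge[OF True] by simp
    qed (use that in \<open>simp add: K_def\<close>)
    show "K (\<alpha>, \<alpha>) > real m * card V" if "\<alpha> \<in> V" for \<alpha>
      using K_diag[OF that] by simp
  qed simp
  then have "K \<in> rcon_model V G"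
    unfolding rcon_model_iff
  proof (intro conjI ballI allI impI)
    show "K (\<alpha>, \<beta>) = 0" if "\<alpha> \<in> V" "\<beta> \<in> V" "\<alpha> \<noteq> \<beta> \<and> {\<alpha>, \<beta>} \<notin> edges G" for \<alpha> \<beta>
      using that by (simp add: K_def)
    show "K (\<alpha>, \<alpha>) = K (\<beta>, \<beta>)" if "(\<alpha>, \<beta>) \<in> vertex_rel G" for \<alpha> \<beta>
      using vertex_rel_Field[OF G that] v that K_diag by simp
    show "K (\<alpha>, \<beta>) = K (\<gamma>, \<delta>)" if "({\<alpha>, \<beta>}, {\<gamma>, \<delta>}) \<in> edge_rel G" for \<alpha> \<beta> \<gamma> \<delta>
      using edge_rel_Field[OF that] e that K_edge by simp
  qed
  moreover have "K (\<alpha>, \<beta>) \<noteq> 0" if "{\<alpha>, \<beta>} \<in> edges G" for \<alpha> \<beta>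
    using K_edge[OF that] by simp
  moreover have "(\<alpha>, \<beta>) \<in> vertex_rel G" if "\<alpha> \<in> V" "\<beta> \<in> V" "K (\<alpha>, \<alpha>) = K (\<beta>, \<beta>)" for \<alpha> \<beta>
    using that v K_diag by simp
  moreover have "({\<alpha>, \<beta>}, {\<gamma>, \<delta>}) \<in> edge_rel G"
    if "{\<alpha>, \<beta>} \<in> edges G" "{\<gamma>, \<delta>} \<in> edges G" "K (\<alpha>, \<beta>) = K (\<gamma>, \<delta>)" for \<alpha> \<beta> \<gamma> \<delta>
    using that e K_edge by simp
  ultimately show thesis
    by (rule that)
qed

text \<open>With antisymmetry of \<open>cg_le\<close>, different graphs represent different models,
  so bounds of models can be computed on graphs. Inclusion of models is tested on the generic matrix
  of \<open>G\<close>.\<close>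

lemma rcon_model_subset_iff:
  assumes V: "finite V" and G: "G \<in> coloured_graphs V" and H: "H \<in> coloured_graphs V"
  shows "rcon_model V G \<subseteq> rcon_model V H \<longleftrightarrow> cg_le V G H"
proof
  assume le: "cg_le V G H"
  note D = cg_leD[OF le G H]
  show "rcon_model V G \<subseteq> rcon_model V H"
  proof
    fix K assume "K \<in> rcon_model V G"
    then have K: "K \<in> sym_pos_def V"
      "\<And>\<alpha> \<beta>. \<lbrakk>\<alpha> \<in> V; \<beta> \<in> V; \<alpha> \<noteq> \<beta>; {\<alpha>, \<beta>} \<notin> edges G\<rbrakk> \<Longrightarrow> K (\<alpha>, \<beta>) = 0"
      "\<And>\<alpha> \<beta>. (\<alpha>, \<beta>) \<in> vertex_rel G \<Longrightarrow> K (\<alpha>, \<alpha>) = K (\<beta>, \<beta>)"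
      "\<And>\<alpha> \<beta> \<gamma> \<delta>. ({\<alpha>, \<beta>}, {\<gamma>, \<delta>}) \<in> edge_rel G \<Longrightarrow> K (\<alpha>, \<beta>) = K (\<gamma>, \<delta>)"
      by (simp_all add: rcon_model_iff)
    show "K \<in> rcon_model V H"
      unfolding rcon_model_iff
    proof (intro conjI ballI allI impI)
      show "K \<in> sym_pos_def V"
        by (rule K)
      show "K (\<alpha>, \<beta>) = 0" if "\<alpha> \<in> V" "\<beta> \<in> V" "\<alpha> \<noteq> \<beta> \<and> {\<alpha>, \<beta>} \<notin> edges H" for \<alpha> \<beta>
        using K(2) that D(1) by blast
      show "K (\<alpha>, \<alpha>) = K (\<beta>, \<beta>)" if "(\<alpha>, \<beta>) \<in> vertex_rel H" for \<alpha> \<beta>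
        using K(3) that D(2) by blast
      show "K (\<alpha>, \<beta>) = K (\<gamma>, \<delta>)" if rel: "({\<alpha>, \<beta>}, {\<gamma>, \<delta>}) \<in> edge_rel H" for \<alpha> \<beta> \<gamma> \<delta>
      \<comment> \<open>A class of \<open>H\<close> either lies inside a class of \<open>G\<close>
        or avoids the edges of \<open>G\<close> altogether; in the second case both entries are
        zero.\<close>
      proof (cases "{\<alpha>, \<beta>} \<in> edges G \<or> {\<gamma>, \<delta>} \<in> edges G")
        case True
        then have "({\<alpha>, \<beta>}, {\<gamma>, \<delta>}) \<in> edge_rel G"
          using D(3) rel symD[OF sym_same_class] by metis
        then show ?thesis
          by (rule K)
      next
        case False
        have "{\<alpha>, \<beta>} \<in> edges H" "{\<gamma>, \<delta>} \<in> edges H"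
          using edge_rel_Field[OF rel] by simp_all
        then have "\<alpha> \<in> V" "\<beta> \<in> V" "\<alpha> \<noteq> \<beta>" "\<gamma> \<in> V" "\<delta> \<in> V" "\<gamma> \<noteq> \<delta>"
          using coloured_graphsD(3,4)[OF H] by fastforce+
        then show ?thesis
          using K(2) False by simp
      qed
    qed
  qed
next
  assume sub: "rcon_model V G \<subseteq> rcon_model V H"
  obtain K where K: "K \<in> rcon_model V G"
    "\<And>\<alpha> \<beta>. {\<alpha>, \<beta>} \<in> edges G \<Longrightarrow> K (\<alpha>, \<beta>) \<noteq> 0"
    "\<And>\<alpha> \<beta>. \<lbrakk>\<alpha> \<in> V; \<beta> \<in> V; K (\<alpha>, \<alpha>) = K (\<beta>, \<beta>)\<rbrakk> \<Longrightarrow> (\<alpha>, \<beta>) \<in> vertex_rel G"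
    "\<And>\<alpha> \<beta> \<gamma> \<delta>. \<lbrakk>{\<alpha>, \<beta>} \<in> edges G; {\<gamma>, \<delta>} \<in> edges G; K (\<alpha>, \<beta>) = K (\<gamma>, \<delta>)\<rbrakk> \<Longrightarrow>
      ({\<alpha>, \<beta>}, {\<gamma>, \<delta>}) \<in> edge_rel G"
    using generic_matrix[OF V G] by metis
  have "K \<in> rcon_model V H"
    using K(1) sub by blast
  then have KH: "\<And>\<alpha> \<beta>. \<lbrakk>\<alpha> \<in> V; \<beta> \<in> V; \<alpha> \<noteq> \<beta>; {\<alpha>, \<beta>} \<notin> edges H\<rbrakk> \<Longrightarrow> K (\<alpha>, \<beta>) = 0"
    "\<And>\<alpha> \<beta>. (\<alpha>, \<beta>) \<in> vertex_rel H \<Longrightarrow> K (\<alpha>, \<alpha>) = K (\<beta>, \<beta>)"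
    "\<And>\<alpha> \<beta> \<gamma> \<delta>. ({\<alpha>, \<beta>}, {\<gamma>, \<delta>}) \<in> edge_rel H \<Longrightarrow> K (\<alpha>, \<beta>) = K (\<gamma>, \<delta>)"
    by (simp_all add: rcon_model_iff)
  have pair: "\<exists>\<alpha> \<beta>. \<alpha> \<in> V \<and> \<beta> \<in> V \<and> \<alpha> \<noteq> \<beta> \<and> e = {\<alpha>, \<beta>}" if "e \<in> edges X" "X \<in> coloured_graphs V" for e X
    using coloured_graphsD(3,4)[OF that(2,1)] by (auto simp: card_2_iff)
  have E: "edges G \<subseteq> edges H"
    using pair[OF _ G] K(2) KH(1) by (metis subsetI)
  moreover have "vertex_rel H \<subseteq> vertex_rel G"
    using K(3) KH(2) vertex_rel_Field[OF H] by (meson subrelI)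
  moreover have "(e, f) \<in> edge_rel G" if e: "e \<in> edges G" and ef: "(e, f) \<in> edge_rel H" for e f
  proof -
    obtain \<alpha> \<beta> where \<alpha>\<beta>: "e = {\<alpha>, \<beta>}"
      using pair[OF e G] by blast
    obtain \<gamma> \<delta> where \<gamma>\<delta>: "f = {\<gamma>, \<delta>}" "\<gamma> \<in> V" "\<delta> \<in> V" "\<gamma> \<noteq> \<delta>"
      using pair[OF conjunct2[OF edge_rel_Field[OF ef]] H] by blast
    have eq: "K (\<alpha>, \<beta>) = K (\<gamma>, \<delta>)"
      using ef KH(3) by (simp add: \<alpha>\<beta> \<gamma>\<delta>)
    \<comment> \<open>Equal colour in \<open>H\<close> makes the entry at \<open>f\<close> equal to
      the nonzero entry at \<open>e\<close>, and off the edges of \<open>G\<close> it would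
      vanish.\<close>
    have "f \<in> edges G"
    proof (rule ccontr)
      assume "f \<notin> edges G"
      moreover have "K (\<gamma>, \<delta>) \<noteq> 0"
        using K(2)[of \<alpha> \<beta>] e eq by (simp add: \<alpha>\<beta>)
      ultimately show False
        using K(1) \<gamma>\<delta> by (simp add: rcon_model_iff)
    qed
    then show ?thesis
      using K(4) e eq by (simp add: \<alpha>\<beta> \<gamma>\<delta>)
  qed
  ultimately show "cg_le V G H"
    by (simp add: cg_le_iff[OF G H])
qed

section \<open>The lattice of regular models\<close>

lemma regular_model_order_simps [simp]:
  "carrier (regular_model_order V) = rcon_model V ` regular_graphs V"
  "le (regular_model_order V) = (\<subseteq>)" "eq (regular_model_order V) = (=)"
  by (simp_all add: regular_model_order_def regular_models_def)

lemma partial_order_regular_model_order: "partial_order (regular_model_order V)"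
  by unfold_locales auto

text \<open>The join is a choice among least upper bounds; their uniqueness in a partial order
  determines the value.\<close>

lemma (in partial_order) join_eqI: "least L s (Upper L {x, y}) \<Longrightarrow> x \<squnion> y = s"
  unfolding join_def sup_def by (rule some_equality) (blast intro: least_unique)+

lemma (in partial_order) meet_eqI: "greatest L i (Lower L {x, y}) \<Longrightarrow> x \<sqinter> y = i"
  unfolding meet_def inf_def by (rule some_equality) (blast intro: greatest_unique)+

lemma rcon_model_regular_subset_iff:
  "\<lbrakk>finite V; G \<in> regular_graphs V; H \<in> regular_graphs V\<rbrakk> \<Longrightarrow>
    rcon_model V G \<subseteq> rcon_model V H \<longleftrightarrow> cg_le V G H"
  by (simp add: rcon_model_subset_iff regular_graphsD(1))

text \<open>The infimum over all coloured graphs is already regular, so it remains greatest when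
  only regular lower bounds compete.\<close>

lemma greatest_regular_model:
  assumes V: "finite V" and A: "A \<subseteq> regular_graphs V"
  shows "greatest (regular_model_order V) (rcon_model V (cg_Inf V A))
    (Lower (regular_model_order V) (rcon_model V ` A))"
proof (rule greatest_LowerI)
  have A': "A \<subseteq> coloured_graphs V"
    using A regular_graphsD(1) by blast
  have I: "cg_Inf V A \<in> regular_graphs V"
    by (rule cg_Inf_regular[OF V A])
  then show "rcon_model V (cg_Inf V A) \<in> carrier (regular_model_order V)"
    by simp
  show "rcon_model V ` A \<subseteq> carrier (regular_model_order V)"
    using A by auto
  show "rcon_model V (cg_Inf V A) \<sqsubseteq>\<^bsub>regular_model_order V\<^esub> M" if M: "M \<in> rcon_model V ` A" for M
  proof -
    obtain G where "G \<in> A" "M = rcon_model V G"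
      using M by blast
    then show ?thesis
      using rcon_model_regular_subset_iff[OF V I, of G] A cg_Inf_lower[OF A'] by auto
  qed
  show "M \<sqsubseteq>\<^bsub>regular_model_order V\<^esub> rcon_model V (cg_Inf V A)"
    if M: "M \<in> Lower (regular_model_order V) (rcon_model V ` A)" for M
  proof -
    obtain X where X: "X \<in> regular_graphs V" "M = rcon_model V X"
      using M Lower_closed[of "regular_model_order V" "rcon_model V ` A"]
      unfolding regular_model_order_simps by blast
    have "cg_le V X G" if "G \<in> A" for G
    proof -
      have "M \<subseteq> rcon_model V G"
        using Lower_memD[OF M imageI[OF that]] A by auto
      then show ?thesis
        using rcon_model_regular_subset_iff[OF V X(1), of G] X(2) A that by auto
    qed
    then show ?thesis
      using rcon_model_regular_subset_iff[OF V X(1) I] X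
        cg_Inf_greatest[OF A' regular_graphsD(1)[OF X(1)]] by simp
  qed
qed

lemma complete_lattice_regular_model_order:
  assumes V: "finite V"
  shows "complete_lattice (regular_model_order V)"
proof (rule partial_order.complete_lattice_criterion1[OF partial_order_regular_model_order])
  show "\<exists>M. greatest (regular_model_order V) M (carrier (regular_model_order V))"
    using greatest_regular_model[OF V, of "{}"] by (metis Lower_empty empty_subsetI image_empty)
  show "\<exists>M. greatest (regular_model_order V) M (Lower (regular_model_order V) B)"
    if "B \<subseteq> carrier (regular_model_order V)" for B
  proof -
    obtain A where "A \<subseteq> regular_graphs V" "B = rcon_model V ` A"
      using \<open>B \<subseteq> _\<close> unfolding regular_model_order_simps by (rule subset_imageE)
    then show ?thesis
      using greatest_regular_model[OF V] by blast
  qed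
qed

lemma meet_regular_model:
  assumes V: "finite V" and G: "G \<in> regular_graphs V" and H: "H \<in> regular_graphs V"
  shows "rcon_model V G \<sqinter>\<^bsub>regular_model_order V\<^esub> rcon_model V H = rcon_model V (cg_Inf V {G, H})"
  using greatest_regular_model[OF V, of "{G, H}"] G H
  by (intro partial_order.meet_eqI[OF partial_order_regular_model_order]) simp

text \<open>\<open>J\<close> has to be least only among the regular upper bounds, not among all
  coloured graphs. This is what \<open>s_R\<close> provides, and it also serves the computations
  with edgeless graphs below.\<close>

lemma join_regular_model:
  assumes V: "finite V" and G: "G \<in> regular_graphs V" and H: "H \<in> regular_graphs V"
    and J: "J \<in> regular_graphs V" "cg_le V G J" "cg_le V H J"
    and least: "\<And>X. \<lbrakk>X \<in> regular_graphs V; cg_le V G X; cg_le V H X\<rbrakk> \<Longrightarrow> cg_le V J X"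
  shows "rcon_model V G \<squnion>\<^bsub>regular_model_order V\<^esub> rcon_model V H = rcon_model V J"
proof (rule partial_order.join_eqI[OF partial_order_regular_model_order], rule least_UpperI)
  note sub = rcon_model_regular_subset_iff[OF V]
  show GH: "{rcon_model V G, rcon_model V H} \<subseteq> carrier (regular_model_order V)"
    using G H by simp
  show "rcon_model V J \<in> carrier (regular_model_order V)"
    using J by simp
  show "M \<sqsubseteq>\<^bsub>regular_model_order V\<^esub> rcon_model V J" if "M \<in> {rcon_model V G, rcon_model V H}" for M
    using that sub[OF G J(1)] sub[OF H J(1)] J by auto
  show "rcon_model V J \<sqsubseteq>\<^bsub>regular_model_order V\<^esub> M"
    if M: "M \<in> Upper (regular_model_order V) {rcon_model V G, rcon_model V H}" for M
  proof -
    obtain X where X: "X \<in> regular_graphs V" "M = rcon_model V X"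
      using M Upper_closed[of "regular_model_order V" "{rcon_model V G, rcon_model V H}"]
      unfolding regular_model_order_simps by blast
    have "rcon_model V G \<subseteq> M" "rcon_model V H \<subseteq> M"
      using Upper_memD[OF M _ GH] by simp_all
    then have "cg_le V J X"
      using least[OF X(1)] sub[OF G X(1)] sub[OF H X(1)] X(2) by simp
    then show ?thesis
      using sub[OF J(1) X(1)] X(2) by simp
  qed
qed

text \<open>Edgeless graphs are regular for every vertex colouring, so the partitions of
  \<open>V\<close>, with refinement reversed, sit inside the order of regular graphs and bring their
  non-distributivity along.\<close>

lemma
  assumes r: "equiv V r"
  shows edgeless_regular: "(V // r, {}) \<in> regular_graphs V"
    and vertex_rel_edgeless: "vertex_rel (V // r, {}) = r"
    and edges_edgeless: "edges (V // r, {}) = {}"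
    and cg_le_edgeless_iff: "X \<in> coloured_graphs V \<Longrightarrow> cg_le V (V // r, {}) X \<longleftrightarrow> vertex_rel X \<subseteq> r"
    and cg_le_edgeless_iff': "X \<in> coloured_graphs V \<Longrightarrow>
      cg_le V X (V // r, {}) \<longleftrightarrow> edges X = {} \<and> r \<subseteq> vertex_rel X"
proof -
  show rel: "vertex_rel (V // r, {}) = r"
    by (simp add: same_class_quotient[OF r])
  show E: "edges (V // r, {}) = {}"
    by (simp add: edges_def)
  have cg: "(V // r, {}) \<in> coloured_graphs V"
    by (rule coloured_graphsI) (simp_all add: E partition_on_quotient[OF r] partition_on_empty)
  then show "(V // r, {}) \<in> regular_graphs V"
    by (simp add: regular_graphs_def regular_def)
  show "cg_le V (V // r, {}) X \<longleftrightarrow> vertex_rel X \<subseteq> r" if "X \<in> coloured_graphs V"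
    unfolding cg_le_iff[OF cg that] rel E by simp
  show "cg_le V X (V // r, {}) \<longleftrightarrow> edges X = {} \<and> r \<subseteq> vertex_rel X" if "X \<in> coloured_graphs V"
    unfolding cg_le_iff[OF that cg] rel E by auto
qed

text \<open>
  The edgeless graphs that identify one of the pairs \<open>ab\<close>, \<open>bc\<close>, \<open>ac\<close> violate distributivity, just
  as in the lattice of partitions of three points.
\<close>

lemma not_distributive_regular_model_order:
  assumes V: "finite V" and card: "card V \<ge> 3"
  shows "\<not> distributive (regular_model_order V)"
proof
  let ?M = "regular_model_order V"
  assume dist: "distributive ?M"
  obtain T where "T \<subseteq> V" "card T = 3"
    using obtain_subset_with_card_n[OF card] by metis
  then obtain a b c where abc: "a \<in> V" "b \<in> V" "c \<in> V" "a \<noteq> b" "b \<noteq> c" "a \<noteq> c"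
    by (auto simp: card_3_iff)
  define r where "r x y = Id_on V \<union> {(x, y), (y, x)}" for x y
  define P where "P x y = (V // r x y, {} :: 'a set set set)" for x y
  define D where "D = (V // Id_on V, {} :: 'a set set set)"
  have r: "equiv V (r x y)" if "x \<in> V" "y \<in> V" for x y
    using that by (intro equivI) (auto simp: r_def refl_on_def sym_def trans_def)
  have Id: "equiv V (Id_on V)"
    by (intro equivI) (auto simp: refl_on_def sym_def trans_def)
  have reg: "P x y \<in> regular_graphs V" if "x \<in> V" "y \<in> V" for x y
    unfolding P_def by (rule edgeless_regular[OF r[OF that]])
  have D: "D \<in> regular_graphs V"
    unfolding D_def by (rule edgeless_regular[OF Id])
  have P_le: "cg_le V (P x y) X \<longleftrightarrow> vertex_rel X \<subseteq> r x y"
    if "x \<in> V" "y \<in> V" "X \<in> coloured_graphs V" for x y X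
    unfolding P_def by (rule cg_le_edgeless_iff[OF r[OF that(1,2)] that(3)])
  have D_le: "cg_le V D X \<longleftrightarrow> vertex_rel X \<subseteq> Id_on V" if "X \<in> coloured_graphs V" for X
    unfolding D_def by (rule cg_le_edgeless_iff[OF Id that])
  have D_rel: "vertex_rel D = Id_on V"
    unfolding D_def by (rule vertex_rel_edgeless[OF Id])
  \<comment> \<open>An upper bound has a vertex colouring finer than both, and \<open>ne\<close>
    leaves only the identity, so the discrete edgeless graph \<open>D\<close> is the least
    one.\<close>
  have join: "rcon_model V (P a b) \<squnion>\<^bsub>?M\<^esub> rcon_model V (P x y) = rcon_model V D"
    if xy: "x \<in> V" "y \<in> V" and ne: "r a b \<inter> r x y \<subseteq> Id_on V" for x y
  proof (rule join_regular_model[OF V reg[OF abc(1,2)] reg[OF xy] D])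
    have "vertex_rel D \<subseteq> r z w" for z w
      unfolding D_rel r_def by blast
    then show "cg_le V (P a b) D" "cg_le V (P x y) D"
      using P_le[OF _ _ regular_graphsD(1)[OF D]] abc xy by blast+
    show "cg_le V D X" if "X \<in> regular_graphs V" "cg_le V (P a b) X" "cg_le V (P x y) X" for X
      using that P_le[OF abc(1,2), of X] P_le[OF xy, of X] D_le[of X] ne regular_graphsD(1)[of X V]
      by blast
  qed
  let ?I = "cg_Inf V {P b c, P a c}"
  have bc_ac: "{P b c, P a c} \<subseteq> regular_graphs V"
    using reg abc by blast
  then have I: "?I \<in> regular_graphs V"
    by (rule cg_Inf_regular[OF V])
  have "edges ?I = {}"
  proof -
    have "edges ?I \<subseteq> edges (P b c)"
      by (auto simp: edges_cg_Inf)
    then show ?thesis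
      unfolding P_def edges_edgeless[OF r[OF abc(2,3)]] by blast
  qed
  moreover have "r a b \<subseteq> vertex_rel ?I"
  proof -
    let ?S = "(\<Union>G\<in>{P b c, P a c}. vertex_rel G)"
    have rel: "vertex_rel (P x y) = r x y" if "x \<in> V" "y \<in> V" for x y
      unfolding P_def by (rule vertex_rel_edgeless[OF r[OF that]])
    have "(a, c) \<in> ?S" "(c, b) \<in> ?S" "(b, c) \<in> ?S" "(c, a) \<in> ?S"
      using abc by (simp_all add: rel r_def)
    \<comment> \<open>\<open>a\<close> and \<open>b\<close> are linked through \<open>c\<close>: the
      infimum colours all three alike and hence lies below \<open>P a b\<close>.\<close>
    then have "(a, b) \<in> ?S\<^sup>*" "(b, a) \<in> ?S\<^sup>*"
      by (meson r_into_rtrancl rtrancl_into_rtrancl)+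
    then show ?thesis
      using abc unfolding vertex_rel_cg_Inf r_def by auto
  qed
  ultimately have "cg_le V ?I (P a b)"
    unfolding P_def using cg_le_edgeless_iff'[OF r[OF abc(1,2)] cg_Inf_coloured] by (simp add: P_def)
  then have "rcon_model V (P a b) \<squnion>\<^bsub>?M\<^esub> rcon_model V ?I = rcon_model V (P a b)"
    using regular_graphsD(1)[OF reg[OF abc(1,2)]] reg[OF abc(1,2)]
    by (intro join_regular_model[OF V _ I]) (auto intro: cg_le_refl)
  moreover have "rcon_model V ?I = rcon_model V (P b c) \<sqinter>\<^bsub>?M\<^esub> rcon_model V (P a c)"
    using meet_regular_model[OF V reg[OF abc(2,3)] reg[OF abc(1,3)]] by simp
  moreover have "rcon_model V (P a b) \<squnion>\<^bsub>?M\<^esub> rcon_model V (P b c) = rcon_model V D"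
    "rcon_model V (P a b) \<squnion>\<^bsub>?M\<^esub> rcon_model V (P a c) = rcon_model V D"
    using abc by (intro join; auto simp: r_def)+
  moreover have "rcon_model V D \<sqinter>\<^bsub>?M\<^esub> rcon_model V D = rcon_model V D"
  proof (rule partial_order.meet_eqI[OF partial_order_regular_model_order], rule greatest_LowerI)
    show "M \<sqsubseteq>\<^bsub>?M\<^esub> rcon_model V D" if "M \<in> Lower ?M {rcon_model V D, rcon_model V D}" for M
      using Lower_memD[OF that] D by simp
  qed (use D in auto)
  \<comment> \<open>The left side of the law is the model of \<open>P a b\<close>, because the meet
    of the other two lies below it; the right side is the meet of the model of \<open>D\<close> with
    itself.\<close>
  ultimately have "rcon_model V (P a b) = rcon_model V D"
    using dist reg abc unfolding distributive_def by simp
  then have "cg_le V D (P a b)"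
    using rcon_model_regular_subset_iff[OF V D reg[OF abc(1,2)]] by simp
  then have "r a b \<subseteq> Id_on V"
    using D_le[OF regular_graphsD(1)[OF reg[OF abc(1,2)]]] vertex_rel_edgeless[OF r[OF abc(1,2)]]
    by (simp add: P_def)
  then show False
    using abc by (auto simp: r_def)
qed

theorem theorem5p15:
  fixes V :: "'a set"
  assumes "finite V"
  shows "complete_lattice (regular_model_order V) \<and>
    (card V \<ge> 3 \<longrightarrow> \<not> distributive (regular_model_order V)) \<and>
    (\<forall>G\<in>regular_graphs V. \<forall>H\<in>regular_graphs V.
       rcon_model V G \<sqinter>\<^bsub>regular_model_order V\<^esub> rcon_model V H =
       rcon_model V (G \<sqinter>\<^bsub>cg_order V\<^esub> H)) \<and>
    (\<forall>G\<in>regular_graphs V. \<forall>H\<in>regular_graphs V.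
       rcon_model V G \<squnion>\<^bsub>regular_model_order V\<^esub> rcon_model V H =
       rcon_model V (s_R V (G \<squnion>\<^bsub>cg_order V\<^esub> H)))"
proof (intro conjI ballI impI)
  show "complete_lattice (regular_model_order V)"
    by (rule complete_lattice_regular_model_order[OF assms])
  show "\<not> distributive (regular_model_order V)" if "card V \<ge> 3"
    by (rule not_distributive_regular_model_order[OF assms that])
next
  fix G H assume G: "G \<in> regular_graphs V" and H: "H \<in> regular_graphs V"
  have GH: "{G, H} \<subseteq> coloured_graphs V"
    using G H regular_graphsD(1) by blast
  have "G \<sqinter>\<^bsub>cg_order V\<^esub> H = cg_Inf V {G, H}"
    by (rule partial_order.meet_eqI[OF partial_order_cg_order greatest_cg_Inf[OF GH]])
  then show "rcon_model V G \<sqinter>\<^bsub>regular_model_order V\<^esub> rcon_model V H =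
      rcon_model V (G \<sqinter>\<^bsub>cg_order V\<^esub> H)"
    using meet_regular_model[OF assms G H] by simp
next
  fix G H assume G: "G \<in> regular_graphs V" and H: "H \<in> regular_graphs V"
  note G' = regular_graphsD(1)[OF G] and H' = regular_graphsD(1)[OF H]
  interpret cg: complete_lattice "cg_order V"
    by (rule complete_lattice_cg_order)
  let ?J = "G \<squnion>\<^bsub>cg_order V\<^esub> H"
  have J: "?J \<in> coloured_graphs V" "cg_le V G ?J" "cg_le V H ?J"
    using cg.join_closed[of G H] cg.join_left[of G H] cg.join_right[of G H] G' H' by simp_all
  note S = s_R_least[OF assms J(1)]
  have S': "s_R V ?J \<in> coloured_graphs V"
    by (rule regular_graphsD(1)[OF S(1)])
  show "rcon_model V G \<squnion>\<^bsub>regular_model_order V\<^esub> rcon_model V H = rcon_model V (s_R V ?J)"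
  proof (rule join_regular_model[OF assms G H S(1)])
    show "cg_le V G (s_R V ?J)" "cg_le V H (s_R V ?J)"
      using cg_le_trans[OF _ J(1) S' _ S(2)] G' H' J by blast+
    \<comment> \<open>A regular upper bound of \<open>G\<close> and \<open>H\<close> is above their
      join in the lattice of all coloured graphs, and leastness of \<open>s_R\<close> among regular
      graphs above that join does the rest.\<close>
    show "cg_le V (s_R V ?J) X"
      if X: "X \<in> regular_graphs V" "cg_le V G X" "cg_le V H X" for X
    proof -
      have "cg_le V ?J X"
        using cg.join_le[of G X H] G' H' X regular_graphsD(1)[OF X(1)] by simp
      then show ?thesis
        by (rule S(3)[OF X(1)])
    qed
  qed
qed

end
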